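(* Let $n\ge 2$, $1<p<\infty$, let $G\subset\mathbb{R}^n$ be open and connected, and let $u$ be a solution to the $p$-Laplace equation in $G$. Assume that the following holds for arbitrary concentric open balls $B_{r_b}=B(z,r_b)$ and $B_{R_b}=B(z,R_b)$, $0<r_b<R_b$, with $B_{r_b}\subset\overline{B}_{R_b}\subset G$: whenever $I(r)>0$ for every $r\in(r_b,R_b]$, then $\|F_p\|_{L^\infty((r_b,R_b])}<\infty$. Then, if $u$ vanishes on some open ball in $G$, $u$ is identically zero in $G$.
   Context: A solution to the $p$-Laplace equation $\nabla\cdot(|\nabla u|^{p-2}\nabla u)=0$ in $G$ is a function $u\in W^{1,p}_{\mathrm{loc}}(G)\cap C^1(G)$ such that $\int_G|\nabla u|^{p-2}\nabla u\cdot\nabla\eta\,dx=0$ for all $\eta\in C_0^\infty(G)$ (weak solutions are known to have a $C^{1,\alpha}_{\mathrm{loc}}$ representative, and $u$ is always taken to be this representative; $|\nabla u|^{p-2}\nabla u$ is understood as $0$ where $\nabla u=0$). $B(z,r)$ denotes the open ball of radius $r$ centered at $z\in G$; $dS$ is the surface element. For concentric balls $B_r=B(z,r)$ with $\overline{B}_r\subset G$, set $I(r)=\int_{\partial B_r}|u|^p\,dS$, and define the frequency function $$F_p(r)=\frac{r\int_{B_r}|\nabla u|^p\,dx}{\int_{\partial B_r}|u|^p\,dS}$$ for those $r$ with $I(r)>0$. Both $I$ and $F_p$ depend on the center $z$. *)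

theory Defs
  imports "HOL-Analysis.Analysis" "HOL-Probability.Essential_Supremum"
begin

definition grad :: "('a::euclidean_space \<Rightarrow> real) \<Rightarrow> 'a \<Rightarrow> 'a" where
  "grad u x = (THE D. GDERIV u x :> D)"

lemma grad_eqI:
  assumes "GDERIV u x :> D"
  shows "grad u x = D"
  unfolding grad_def
proof (rule the_equality[where P = "\<lambda>D. GDERIV u x :> D", OF assms])
  fix D' assume "GDERIV u x :> D'"
  then have "(\<lambda>h. h \<bullet> D') = (\<lambda>h. h \<bullet> D)"
    using assms unfolding gderiv_def by (rule has_derivative_unique)
  then have "\<And>h. h \<bullet> D' = h \<bullet> D" by metis
  then show "D' = D" by (metis vector_eq_ldot)
qed

primrec Ck_on :: "nat \<Rightarrow> 'a::euclidean_space set \<Rightarrow> ('a \<Rightarrow> real) \<Rightarrow> bool" where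
  "Ck_on 0 G f \<longleftrightarrow> continuous_on G f"
| "Ck_on (Suc k) G f \<longleftrightarrow>
     (\<forall>x\<in>G. f differentiable (at x)) \<and> (\<forall>e\<in>Basis. Ck_on k G (\<lambda>x. grad f x \<bullet> e))"

text \<open>Elements of \<open>C\<^sub>0\<^sup>\<infinity>(G)\<close>, extended by zero to the whole space.\<close>

definition test_function :: "'a::euclidean_space set \<Rightarrow> ('a \<Rightarrow> real) \<Rightarrow> bool" where
  "test_function G \<eta> \<longleftrightarrow>
     (\<forall>k. Ck_on k UNIV \<eta>) \<and> compact (closure {x. \<eta> x \<noteq> 0}) \<and> closure {x. \<eta> x \<noteq> 0} \<subseteq> G"

definition Lp_loc ::
  "real \<Rightarrow> 'a::euclidean_space set \<Rightarrow> ('a \<Rightarrow> 'b::euclidean_space) \<Rightarrow> bool" where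
  "Lp_loc p G f \<longleftrightarrow>
     (\<forall>K. compact K \<and> K \<subseteq> G \<longrightarrow>
        set_borel_measurable lebesgue K f \<and> set_integrable lebesgue K (\<lambda>x. norm (f x) powr p))"

definition weak_gradient ::
  "'a::euclidean_space set \<Rightarrow> ('a \<Rightarrow> real) \<Rightarrow> ('a \<Rightarrow> 'a) \<Rightarrow> bool" where
  "weak_gradient G u g \<longleftrightarrow>
     (\<forall>\<eta>. test_function G \<eta> \<longrightarrow> (\<forall>e\<in>Basis.
        (LINT x:G|lebesgue. u x * (grad \<eta> x \<bullet> e)) = - (LINT x:G|lebesgue. (g x \<bullet> e) * \<eta> x)))"

definition W1p_loc :: "real \<Rightarrow> 'a::euclidean_space set \<Rightarrow> ('a \<Rightarrow> real) \<Rightarrow> bool" where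
  "W1p_loc p G u \<longleftrightarrow> Lp_loc p G u \<and> (\<exists>g. Lp_loc p G g \<and> weak_gradient G u g)"

text \<open>For \<open>u\<close> of class \<open>C\<^sup>1\<close> the weak gradient is the classical one. The field
  \<open>|\<nabla>u|\<^sup>p\<^sup>-\<^sup>2\<nabla>u\<close> is \<open>0\<close> where \<open>\<nabla>u = 0\<close>, for every \<open>p\<close>, as it should be.\<close>

definition p_laplace_solution ::
  "real \<Rightarrow> 'a::euclidean_space set \<Rightarrow> ('a \<Rightarrow> real) \<Rightarrow> bool" where
  "p_laplace_solution p G u \<longleftrightarrow>
     W1p_loc p G u \<and> Ck_on 1 G u \<and>
     (\<forall>\<eta>. test_function G \<eta> \<longrightarrow>
        (LINT x:G|lebesgue. ((norm (grad u x) powr (p - 2)) *\<^sub>R grad u x) \<bullet> grad \<eta> x) = 0)"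

text \<open>Surface measure on the sphere of radius \<open>r > 0\<close> about \<open>z\<close>: the measure of a set \<open>A\<close> is
  \<open>n/r\<close> times the volume of the cone over \<open>A\<close> with apex \<open>z\<close>. It is obtained by
  pushing Lebesgue measure on the punctured ball forward along the radial projection
  to the sphere. It lives on the Borel sets of the whole space and is carried by the sphere.\<close>

definition sphere_measure :: "'a::euclidean_space \<Rightarrow> real \<Rightarrow> 'a measure" where
  "sphere_measure z r =
     scale_measure (ennreal (real DIM('a) / r))
       (distr (restrict_space lborel (ball z r - {z})) borel
          (\<lambda>x. z + (r / norm (x - z)) *\<^sub>R (x - z)))"

lemma sets_sphere_measure [simp]: "sets (sphere_measure z r) = sets borel"
  by (simp add: sphere_measure_def)

lemma space_sphere_measure [simp]: "space (sphere_measure z r) = UNIV"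
  by (simp add: sphere_measure_def space_scale_measure)

lemma emeasure_sphere_measure:
  fixes z :: "'a::euclidean_space"
  assumes "A \<in> sets borel"
  shows "emeasure (sphere_measure z r) A =
    ennreal (real DIM('a) / r) *
      emeasure lborel {x \<in> ball z r - {z}. z + (r / norm (x - z)) *\<^sub>R (x - z) \<in> A}"
proof -
  let ?h = "\<lambda>x. z + (r / norm (x - z)) *\<^sub>R (x - z)"
  have h [measurable]: "?h \<in> restrict_space lborel (ball z r - {z}) \<rightarrow>\<^sub>M borel"
    by (intro measurable_restrict_space1) measurable
  have eq: "?h -` A \<inter> (ball z r - {z}) = {x \<in> ball z r - {z}. ?h x \<in> A}" by auto
  have "emeasure (restrict_space lborel (ball z r - {z})) {x \<in> ball z r - {z}. ?h x \<in> A} =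
      emeasure lborel {x \<in> ball z r - {z}. ?h x \<in> A}"
    by (rule emeasure_restrict_space) auto
  then show ?thesis
    unfolding sphere_measure_def using assms h
    by (simp only: emeasure_scale_measure emeasure_distr[OF h assms] space_restrict_space
        space_lborel space_borel Int_UNIV_right eq)
qed

lemma emeasure_sphere_measure_sphere:
  fixes z :: "'a::euclidean_space"
  assumes "r > 0"
  shows "emeasure (sphere_measure z r) (sphere z r) =
    ennreal (real DIM('a) * unit_ball_vol (real DIM('a)) * r ^ (DIM('a) - 1))"
proof -
  have "{x \<in> ball z r - {z}. z + (r / norm (x - z)) *\<^sub>R (x - z) \<in> sphere z r} = ball z r - {z}"
    using assms by (auto simp: dist_norm)
  moreover have "emeasure lborel (ball z r - {z}) = emeasure lborel (ball z r)"
    by (intro emeasure_Diff_null_set) auto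
  moreover have "r ^ DIM('a) = r * r ^ (DIM('a) - 1)"
    using DIM_positive by (metis power_eq_if not_gr_zero)
  ultimately show ?thesis
    using assms by (simp add: emeasure_sphere_measure emeasure_ball
        flip: ennreal_mult)
qed

definition sphere_integral ::
  "real \<Rightarrow> ('a::euclidean_space \<Rightarrow> real) \<Rightarrow> 'a \<Rightarrow> real \<Rightarrow> real" where
  "sphere_integral p u z r = (LINT x:sphere z r|sphere_measure z r. \<bar>u x\<bar> powr p)"

definition frequency ::
  "real \<Rightarrow> ('a::euclidean_space \<Rightarrow> real) \<Rightarrow> 'a \<Rightarrow> real \<Rightarrow> real" where
  "frequency p u z r =
     r * (LINT x:ball z r|lebesgue. norm (grad u x) powr p) / sphere_integral p u z r"

end

theory Submission
  imports Defs
begin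

text \<open>Suppose that \<open>u\<close> vanishes on \<open>B(z,a)\<close>, and let \<open>D(r)\<close> be the integral of
  \<open>|\<nabla>u|\<^sup>p\<close> over \<open>B(z,r)\<close>. Integrating \<open>\<nabla>u\<close> along the rays from \<open>z\<close> between the radii
  \<open>a\<close> and \<open>r\<close>, Hoelder's inequality gives
  \<open>I(r) \<le> (r - a)\<^sup>p\<^sup>-\<^sup>1 (r/a)\<^sup>n\<^sup>-\<^sup>1 D(r)\<close>. If \<open>F\<^sub>p \<le> M\<close> near \<open>a\<close>, that is
  \<open>r D(r) \<le> M I(r)\<close>, this is impossible for \<open>r\<close> close to \<open>a\<close> and \<open>I(r) > 0\<close>. So \<open>I(r) = 0\<close>
  for some \<open>r > a\<close>, and then \<open>u\<close> vanishes on \<open>B(z,r)\<close>: test the equation with a \<open>C\<^sup>1\<close> truncation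
  of \<open>u\<close>. Hence zero balls grow until they reach the boundary of \<open>G\<close>, and the interior of the zero
  set is closed in \<open>G\<close>.\<close>

section \<open>Smooth bump functions\<close>

text \<open>Test functions are smooth by definition, whereas a truncation of a solution is only as
  regular as \<open>u\<close>, that is C^1. So the weak form has to be extended to compactly
  supported C^1 functions. The function \<open>u\<close> itself is no admissible test function on a
  ball on whose boundary it vanishes, because its support may reach the sphere. Cutting off the
  values with |u| at most epsilon leaves a support inside the open ball, and squaring the positive
  parts keeps the truncation C^1. The frequency is bounded only essentially, so the bound must be
  used at a radius outside a null set; such radii exist arbitrarily close to a. The contradiction
  there comes from p > 1, which sends (r - a)^(p-1) to 0 while (r/a)^(n-1) tends to 1. As surface
  measure is defined by cones, I(r) is a volume integral of a function that is constant along rays.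
  This is why an inequality in polar coordinates is enough; its weight is under control because the
  rays are followed only from distance a > 0 on.\<close>

definition flat :: "nat \<Rightarrow> real \<Rightarrow> real" where
  "flat k t = (if t > 0 then exp (- inverse t) * inverse t ^ k else 0)"

lemma flat_nonneg: "flat k t \<ge> 0"
  by (simp add: flat_def)

lemma flat_tendsto_0: "(flat k \<longlongrightarrow> 0) (at 0)"
proof -
  have "((\<lambda>t. inverse t ^ k / exp (inverse t)) \<longlongrightarrow> 0) (at_right (0::real))"
    using filterlim_compose[OF tendsto_power_div_exp_0 filterlim_inverse_at_top_right] .
  then have "(flat k \<longlongrightarrow> 0) (at_right 0)"
    by (rule Lim_transform_eventually)
      (auto simp: flat_def exp_minus field_simps eventually_at_filter)
  moreover have "(flat k \<longlongrightarrow> 0) (at_left 0)"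
    by (rule tendsto_eventually) (auto simp: flat_def eventually_at_filter)
  ultimately show ?thesis
    by (simp add: filterlim_at_split)
qed

text \<open>For t > 0, every derivative of exp(-1/t) is exp(-1/t) times a polynomial in 1/t. Keeping
  the power of \<open>inverse t\<close> as the index \<open>k\<close> makes the family closed under
  differentiation up to linear combinations.\<close>

lemma has_real_derivative_flat:
  "(flat k has_real_derivative (flat (k + 2) t - real k * flat (k + 1) t)) (at t)"
proof -
  consider "t > 0" | "t < 0" | "t = 0" by linarith
  then show ?thesis
  proof cases
    case 1
    have "((\<lambda>t. exp (- inverse t) * inverse t ^ k) has_real_derivative
        (exp (- inverse t) * inverse t ^ (k + 2) -
          (real k * inverse t ^ (k - 1) * inverse t) * inverse t * exp (- inverse t))) (at t)"
      using 1 by (auto intro!: derivative_eq_intros simp: power2_eq_square)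
    \<comment> \<open>Natural subtraction: for \<open>k = 0\<close> the exponent
      \<open>k - 1\<close> is not -1, but the factor \<open>real k\<close> removes the term.\<close>
    moreover have "real k * inverse t ^ (k - 1) * inverse t = real k * inverse t ^ k"
      by (cases k) auto
    ultimately have "((\<lambda>t. exp (- inverse t) * inverse t ^ k) has_real_derivative
        (exp (- inverse t) * inverse t ^ (k + 2) -
          (real k * inverse t ^ k) * inverse t * exp (- inverse t))) (at t)"
      by (simp only:)
    then have "((\<lambda>t. exp (- inverse t) * inverse t ^ k) has_real_derivative
        (flat (k + 2) t - real k * flat (k + 1) t)) (at t)"
      using 1 by (simp add: flat_def mult_ac)
    then show ?thesis
      by (rule has_field_derivative_transform_within_open[where S = "{0<..}"])
        (use 1 in \<open>auto simp: flat_def\<close>)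
  next
    case 2
    have "((\<lambda>t. 0) has_real_derivative (flat (k + 2) t - real k * flat (k + 1) t)) (at t)"
      using 2 by (simp add: flat_def)
    then show ?thesis
      by (rule has_field_derivative_transform_within_open[where S = "{..<0}"])
        (use 2 in \<open>auto simp: flat_def\<close>)
  next
    case 3
    \<comment> \<open>The difference quotient of \<open>flat k\<close> at 0 is
      \<open>flat (Suc k)\<close>, which tends to 0.\<close>
    have "((\<lambda>h. (flat k (0 + h) - flat k 0) / h) \<longlongrightarrow> 0) (at 0)"
      by (rule Lim_transform_eventually[OF flat_tendsto_0[of "Suc k"]])
        (auto simp: flat_def field_simps eventually_at_filter)
    then show ?thesis
      using 3 by (simp add: DERIV_def flat_def)
  qed
qed

lemma continuous_on_flat [continuous_intros]:
  "continuous_on S f \<Longrightarrow> continuous_on S (\<lambda>x. flat k (f x))"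
  using DERIV_continuous_on[OF has_field_derivative_at_within[OF has_real_derivative_flat], of UNIV k]
  by (rule continuous_on_compose2) auto

text \<open>The algebraic closure of the functions \<open>flat k (s - \<bar>x - c\<bar>\<^sup>2)\<close> under the operations that
  occur in their partial derivatives: it is closed under differentiation, hence smooth.\<close>

inductive bump_like :: "'a::euclidean_space \<Rightarrow> real \<Rightarrow> ('a \<Rightarrow> real) \<Rightarrow> bool" for c s where
  flat: "bump_like c s (\<lambda>x. flat k (s - (x - c) \<bullet> (x - c)))"
| scale: "bump_like c s f \<Longrightarrow> bump_like c s (\<lambda>x. a * f x)"
| coord: "bump_like c s f \<Longrightarrow> bump_like c s (\<lambda>x. ((x - c) \<bullet> e) * f x)"
| add: "bump_like c s f \<Longrightarrow> bump_like c s g \<Longrightarrow> bump_like c s (\<lambda>x. f x + g x)"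

lemma GDERIV_flat_ball:
  "GDERIV (\<lambda>x. flat k (s - (x - c) \<bullet> (x - c))) x :>
    (- 2 * (flat (k + 2) (s - (x - c) \<bullet> (x - c)) - real k * flat (k + 1) (s - (x - c) \<bullet> (x - c)))) *\<^sub>R (x - c)"
proof -
  have "((\<lambda>x. s - (x - c) \<bullet> (x - c)) has_derivative (\<lambda>h. h \<bullet> ((- 2) *\<^sub>R (x - c)))) (at x)"
    by (auto intro!: derivative_eq_intros simp: inner_commute)
  from DERIV_compose_FDERIV[OF has_real_derivative_flat this, of k]
  show ?thesis unfolding gderiv_def by (simp add: algebra_simps)
qed

text \<open>The gradient of a generator is a multiple of \<open>x - c\<close>, hence the closure
  under \<open>coord\<close>; differentiating the factor \<open>(x - c) \<bullet> e\<close> only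
  adds a constant multiple of the other factor. So all components of gradients stay in the
  class.\<close>

lemma bump_like_GDERIV:
  assumes "bump_like c s f"
  shows "\<exists>D. (\<forall>x. GDERIV f x :> D x) \<and> (\<forall>e. bump_like c s (\<lambda>x. D x \<bullet> e))"
  using assms
proof induction
  case (flat k)
  have "bump_like c s (\<lambda>x. ((x - c) \<bullet> e) * ((- 2) * flat (k + 2) (s - (x - c) \<bullet> (x - c)) +
      (2 * real k) * flat (k + 1) (s - (x - c) \<bullet> (x - c))))" for e
    by (intro bump_like.intros)
  then show ?case
    by (intro exI[of _ "\<lambda>x. (- 2 * (flat (k + 2) (s - (x - c) \<bullet> (x - c)) -
          real k * flat (k + 1) (s - (x - c) \<bullet> (x - c)))) *\<^sub>R (x - c)"] conjI allI GDERIV_flat_ball)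
      (simp add: algebra_simps)
next
  case (scale f a)
  then obtain D where D: "\<And>x. GDERIV f x :> D x" "\<And>e. bump_like c s (\<lambda>x. D x \<bullet> e)" by blast
  have "GDERIV (\<lambda>x. a * f x) x :> a *\<^sub>R D x" for x
    using D(1)[of x] unfolding gderiv_def by (auto intro!: derivative_eq_intros)
  then show ?case
    using D(2) by (intro exI[of _ "\<lambda>x. a *\<^sub>R D x"]) (auto intro: bump_like.scale)
next
  case (coord f e)
  then obtain D where D: "\<And>x. GDERIV f x :> D x" "\<And>e. bump_like c s (\<lambda>x. D x \<bullet> e)" by blast
  have "GDERIV (\<lambda>x. ((x - c) \<bullet> e) * f x) x :> f x *\<^sub>R e + ((x - c) \<bullet> e) *\<^sub>R D x" for x
    using D(1)[of x] unfolding gderiv_def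
    by (auto intro!: derivative_eq_intros simp: algebra_simps inner_commute)
  moreover have "bump_like c s (\<lambda>x. (e \<bullet> e') * f x + ((x - c) \<bullet> e) * (D x \<bullet> e'))" for e'
    using coord.hyps D(2) by (intro bump_like.intros)
  ultimately show ?case
    by (intro exI[of _ "\<lambda>x. f x *\<^sub>R e + ((x - c) \<bullet> e) *\<^sub>R D x"])
      (auto simp: inner_add_left mult_ac)
next
  case (add f g)
  then obtain D E where D: "\<And>x. GDERIV f x :> D x" "\<And>e. bump_like c s (\<lambda>x. D x \<bullet> e)"
    and E: "\<And>x. GDERIV g x :> E x" "\<And>e. bump_like c s (\<lambda>x. E x \<bullet> e)" by metis
  have "GDERIV (\<lambda>x. f x + g x) x :> D x + E x" for x
    using D(1) E(1) by (rule GDERIV_add)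
  moreover have "bump_like c s (\<lambda>x. D x \<bullet> e + E x \<bullet> e)" for e
    using D(2) E(2) by (rule bump_like.add)
  ultimately show ?case
    by (intro exI[of _ "\<lambda>x. D x + E x"]) (auto simp: inner_add_left)
qed

lemma Ck_on_bump_like: "bump_like c s f \<Longrightarrow> Ck_on k UNIV f"
proof (induction k arbitrary: f)
  case 0
  then obtain D where "\<And>x. GDERIV f x :> D x" using bump_like_GDERIV by blast
  then show ?case
    unfolding gderiv_def by (auto intro!: has_derivative_continuous_on intro: has_derivative_at_withinI)
next
  case (Suc k)
  then obtain D where D: "\<And>x. GDERIV f x :> D x" "\<And>e. bump_like c s (\<lambda>x. D x \<bullet> e)"
    using bump_like_GDERIV by blast
  then have "grad f = D" by (auto intro: grad_eqI)
  moreover have "f differentiable (at x)" for x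
    using D(1)[of x] unfolding gderiv_def by (rule differentiableI)
  ultimately show ?case using Suc.IH D(2) by simp
qed

text \<open>The standard bump exp(-1/(epsilon^2 - |v|^2)); the squared norm keeps it smooth at the
  origin. It is not normalised: its mass appears as \<open>m\<close> in
  \<open>weak_form_C1\<close>.\<close>

definition bump :: "real \<Rightarrow> 'a::euclidean_space \<Rightarrow> real" where
  "bump \<epsilon> v = flat 0 (\<epsilon>\<^sup>2 - v \<bullet> v)"

definition grad_bump :: "real \<Rightarrow> 'a::euclidean_space \<Rightarrow> 'a" where
  "grad_bump \<epsilon> v = (- 2 * flat 2 (\<epsilon>\<^sup>2 - v \<bullet> v)) *\<^sub>R v"

lemma GDERIV_bump: "GDERIV (\<lambda>x. bump \<epsilon> (x - y)) x :> grad_bump \<epsilon> (x - y)"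
  using GDERIV_flat_ball[of 0 "\<epsilon>\<^sup>2" y x] by (simp add: bump_def[abs_def] grad_bump_def numeral_2_eq_2)

lemma
  fixes v :: "'a::euclidean_space"
  assumes "\<epsilon> > 0" "\<epsilon> \<le> norm v"
  shows bump_eq_0: "bump \<epsilon> v = 0" and grad_bump_eq_0: "grad_bump \<epsilon> v = 0"
proof -
  have "\<epsilon>\<^sup>2 \<le> v \<bullet> v"
    using assms unfolding dot_square_norm by (intro power_mono) auto
  then show "bump \<epsilon> v = 0" "grad_bump \<epsilon> v = 0"
    by (auto simp: bump_def grad_bump_def flat_def)
qed

lemma bump_pos:
  assumes "norm v < \<epsilon>"
  shows "bump \<epsilon> v > 0"
proof -
  have "v \<bullet> v < \<epsilon>\<^sup>2"
    using assms unfolding dot_square_norm by (intro power_strict_mono) auto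
  then show ?thesis by (simp add: bump_def flat_def)
qed

lemma bump_nonneg: "bump \<epsilon> v \<ge> 0"
  by (simp add: bump_def flat_nonneg)

lemma continuous_on_bump [continuous_intros]:
  "continuous_on S f \<Longrightarrow> continuous_on S (\<lambda>x. bump \<epsilon> (f x))"
  unfolding bump_def by (intro continuous_intros)

lemma continuous_on_grad_bump [continuous_intros]:
  "continuous_on S f \<Longrightarrow> continuous_on S (\<lambda>x. grad_bump \<epsilon> (f x))"
  unfolding grad_bump_def by (intro continuous_intros)

lemma test_function_bump:
  fixes y :: "'a::euclidean_space"
  assumes "\<epsilon> > 0" "cball y \<epsilon> \<subseteq> G"
  shows "test_function G (\<lambda>x. bump \<epsilon> (x - y))"
proof -
  have "bump_like y (\<epsilon>\<^sup>2) (\<lambda>x. bump \<epsilon> (x - y))"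
    unfolding bump_def by (rule bump_like.flat)
  then have Ck: "\<forall>k. Ck_on k UNIV (\<lambda>x. bump \<epsilon> (x - y))"
    by (blast intro: Ck_on_bump_like)
  have "{x. bump \<epsilon> (x - y) \<noteq> 0} \<subseteq> cball y \<epsilon>"
    using bump_eq_0[OF \<open>\<epsilon> > 0\<close>] by (force simp: dist_norm norm_minus_commute)
  then have sub: "closure {x. bump \<epsilon> (x - y) \<noteq> 0} \<subseteq> cball y \<epsilon>"
    by (simp add: closure_minimal)
  then have "compact (closure {x. bump \<epsilon> (x - y) \<noteq> 0})"
    using compact_cball compact_eq_bounded_closed bounded_subset by (metis closed_closure)
  with Ck sub assms show ?thesis unfolding test_function_def by blast
qed

section \<open>Testing against functions of class \<open>C\<^sup>1\<close>\<close>

lemma integrable_compact_support: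
  fixes f :: "'a::euclidean_space \<Rightarrow> real"
  assumes "continuous_on UNIV f" "compact K" "\<And>x. x \<notin> K \<Longrightarrow> f x = 0"
  shows "integrable lborel f"
proof -
  have "integrable lborel (\<lambda>x. indicator K x *\<^sub>R f x)"
    using assms(2) by (intro borel_integrable_compact continuous_on_subset[OF assms(1)]) auto
  moreover have "(\<lambda>x. indicator K x *\<^sub>R f x) = f"
    using assms(3) by (auto simp: indicator_def fun_eq_iff)
  ultimately show ?thesis by simp
qed

lemma lborel_integral_translate:
  fixes f :: "'a::euclidean_space \<Rightarrow> real"
  assumes "f \<in> borel_measurable borel"
  shows "(LINT x|lborel. f (c + x)) = integral\<^sup>L lborel f"
  using integral_distr[of "(+) c" lborel borel f] assms by (simp add: lborel_distr_plus)

lemma lborel_integrable_translate: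
  fixes f :: "'a::euclidean_space \<Rightarrow> real"
  assumes "integrable lborel f"
  shows "integrable lborel (\<lambda>x. f (c + x))"
proof -
  have "f \<in> borel_measurable borel" using assms by auto
  then show ?thesis
    using integrable_distr_eq[of "(+) c" lborel borel f] assms by (simp add: lborel_distr_plus)
qed

text \<open>By translation invariance the difference quotients of \<open>f\<close> have integral \<open>0\<close>.\<close>

lemma integral_directional_derivative_eq_0:
  fixes f :: "'a::euclidean_space \<Rightarrow> real" and f' :: "'a \<Rightarrow> 'a"
  assumes f: "\<And>x. GDERIV f x :> f' x" and cont: "continuous_on UNIV f'"
    and K: "compact K" "\<And>x. x \<notin> K \<Longrightarrow> f x = 0" "\<And>x. x \<notin> K \<Longrightarrow> f' x = 0"
  shows "(LINT x|lborel. b \<bullet> f' x) = 0"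
proof -
  have contf: "continuous_on UNIV f"
    using f unfolding gderiv_def by (auto intro!: has_derivative_continuous_on intro: has_derivative_at_withinI)
  have int: "integrable lborel f"
    using contf K by (intro integrable_compact_support)
  define q where "q k x = real (Suc k) * (f (inverse (Suc k) *\<^sub>R b + x) - f x)" for k :: nat and x
  have q_int: "integral\<^sup>L lborel (q k) = 0" for k
  proof -
    note trans = lborel_integrable_translate[OF int, of "inverse (real (Suc k)) *\<^sub>R b"]
      lborel_integral_translate[OF borel_measurable_integrable[OF int, simplified], of "inverse (real (Suc k)) *\<^sub>R b"]
    show ?thesis
      unfolding q_def[abs_def] using int trans by simp
  qed
  from compact_imp_bounded[OF compact_continuous_image[OF continuous_on_subset[OF cont] K(1)]]
  obtain M0 where M0: "\<And>x. x \<in> K \<Longrightarrow> norm (f' x) \<le> M0" unfolding bounded_iff by auto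
  \<comment> \<open>For empty \<open>K\<close> the bound \<open>M0\<close> could be
    negative.\<close>
  define M where "M = max M0 0"
  have M: "norm (f' x) \<le> M" for x
    using M0 K(3) by (cases "x \<in> K") (force simp: M_def)+
  obtain R where R: "\<And>x. x \<in> K \<Longrightarrow> norm x \<le> R"
    using compact_imp_bounded[OF K(1)] unfolding bounded_iff by auto
  \<comment> \<open>The mean value theorem bounds each quotient by \<open>norm b * M\<close>. The
    shifts have length at most \<open>norm b\<close>, so all quotients vanish outside the ball of
    radius \<open>R + norm b\<close>, and one integrable majorant serves every
    \<open>k\<close>.\<close>
  define w where "w x = indicator (cball 0 (R + norm b)) x * (norm b * M)" for x :: 'a
  have q_le: "norm (q k x) \<le> w x" for k x
  proof (cases "norm x \<le> R + norm b")
    case True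
    have "norm (f (inverse (Suc k) *\<^sub>R b + x) - f x) \<le> M * norm ((inverse (Suc k) *\<^sub>R b + x) - x)"
    proof (rule differentiable_bound[where S = UNIV and f' = "\<lambda>x h. h \<bullet> f' x"])
      show "onorm (\<lambda>h. h \<bullet> f' x) \<le> M" for x
        by (intro onorm_le) (metis Cauchy_Schwarz_ineq2 M mult.commute mult_right_mono norm_ge_zero order_trans real_norm_def)
    qed (use f in \<open>auto simp: gderiv_def\<close>)
    then have "real (Suc k) * norm (f (inverse (Suc k) *\<^sub>R b + x) - f x) \<le> norm b * M"
      by (simp add: field_simps)
    then show ?thesis
      using True by (simp add: q_def w_def abs_mult)
  next
    case False
    have "norm (inverse (Suc k) *\<^sub>R b) \<le> norm b"
      by (simp add: field_simps)
    then have "norm (inverse (Suc k) *\<^sub>R b + x) > R"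
      using False norm_triangle_ineq4[of "inverse (Suc k) *\<^sub>R b + x" "inverse (Suc k) *\<^sub>R b"] by simp
    moreover have "norm x > R" using False by (smt (verit) norm_ge_zero)
    ultimately have "f (inverse (Suc k) *\<^sub>R b + x) = 0" "f x = 0"
      using R K(2) by (meson not_le)+
    then show ?thesis by (simp add: q_def w_def M_def)
  qed
  have q_lim: "(\<lambda>k. q k x) \<longlonglongrightarrow> b \<bullet> f' x" for x
  proof -
    have "((\<lambda>t. x + t *\<^sub>R b) has_derivative (\<lambda>t. t *\<^sub>R b)) (at 0)"
      by (auto intro!: derivative_eq_intros)
    moreover have "(f has_derivative (\<lambda>h. h \<bullet> f' x)) (at (x + 0 *\<^sub>R b))"
      using f[of x] by (simp add: gderiv_def)
    ultimately have "((\<lambda>t. f (x + t *\<^sub>R b)) has_derivative (\<lambda>t. (t *\<^sub>R b) \<bullet> f' x)) (at 0)"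
      using has_derivative_compose by blast
    then have "((\<lambda>t. f (x + t *\<^sub>R b)) has_real_derivative (b \<bullet> f' x)) (at 0)"
      by (simp add: has_field_derivative_def mult_commute_abs)
    then have "((\<lambda>t. (f (x + t *\<^sub>R b) - f x) / t) \<longlongrightarrow> b \<bullet> f' x) (at 0)"
      by (simp add: DERIV_def)
    moreover have "filterlim (\<lambda>k. inverse (real (Suc k))) (at 0) sequentially"
      using LIMSEQ_inverse_real_of_nat by (simp add: filterlim_at)
    ultimately show ?thesis
      unfolding q_def by (drule_tac filterlim_compose) (auto simp: field_simps add.commute)
  qed
  have "(\<lambda>k. integral\<^sup>L lborel (q k)) \<longlonglongrightarrow> (LINT x|lborel. b \<bullet> f' x)"
  proof (rule integral_dominated_convergence[where w = w])
    show "integrable lborel w"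
      unfolding w_def[abs_def]
      by (intro integrable_mult_left integrable_real_indicator) (use emeasure_compact_finite[OF compact_cball] in auto)
  qed (use q_lim q_le contf cont in \<open>auto simp: q_def[abs_def] intro!: borel_measurable_continuous_onI continuous_intros continuous_on_compose2[OF contf]\<close>)
  then show ?thesis
    unfolding q_int using LIMSEQ_unique tendsto_const by blast
qed

lemma integral_norm_le_integral:
  fixes f g :: "'a \<Rightarrow> real"
  assumes "integrable M f" "integrable M g" "\<And>x. norm (f x) \<le> g x"
  shows "norm (integral\<^sup>L M f) \<le> integral\<^sup>L M g"
  using assms
  by (intro order_trans[OF Bochner_Integration.integral_norm_bound] Bochner_Integration.integral_mono) auto

text \<open>Multiply the weak form with the test functions \<open>bump \<epsilon> (x - y)\<close> by \<open>\<eta> y\<close> and integrate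
  over \<open>y\<close>: after Fubini and an integration by parts in \<open>y\<close> the test field is a mollification
  of \<open>g\<close>. Smoothness of the mollified \<open>\<eta>\<close> is never needed.\<close>

lemma weak_form_C1:
  fixes A :: "'a::euclidean_space \<Rightarrow> 'a" and \<eta> :: "'a \<Rightarrow> real" and g :: "'a \<Rightarrow> 'a"
  assumes "open G" and meas [measurable]: "A \<in> borel_measurable borel"
    and bdd: "\<And>K. compact K \<Longrightarrow> K \<subseteq> G \<Longrightarrow> bounded (A ` K)"
    and weak: "\<And>\<phi>. test_function G \<phi> \<Longrightarrow> (LINT x:G|lborel. A x \<bullet> grad \<phi> x) = 0"
    and \<eta>: "\<And>x. GDERIV \<eta> x :> g x" and cont: "continuous_on UNIV g"
    and K: "compact K" "K \<subseteq> G" "\<And>x. x \<notin> K \<Longrightarrow> \<eta> x = 0" "\<And>x. x \<notin> K \<Longrightarrow> g x = 0"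
  shows "(LINT x|lborel. A x \<bullet> g x) = 0"
proof -
  obtain e0 where e0: "e0 > 0" "(\<Union>x\<in>K. cball x e0) \<subseteq> G"
    using compact_subset_open_imp_cball_epsilon_subset[OF K(1) \<open>open G\<close> K(2)] by blast
  define K1 where "K1 = (\<Union>x\<in>K. \<Union>y\<in>cball 0 e0. {x + y})"
  have K1_cball: "K1 = (\<Union>x\<in>K. cball x e0)"
  proof -
    have "z \<in> cball x e0 \<longleftrightarrow> (\<exists>y\<in>cball 0 e0. z = x + y)" for x z :: 'a
      by (auto simp: dist_norm norm_minus_commute intro!: bexI[of _ "z - x"])
    then show ?thesis unfolding K1_def by blast
  qed
  have cK1: "compact K1" unfolding K1_def by (intro compact_sums' K(1) compact_cball)
  have K1: "K1 \<subseteq> G" "K \<subseteq> K1" using e0 by (auto simp: K1_cball intro: less_imp_le)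
  have [measurable]: "K1 \<in> sets borel" using cK1 by (simp add: borel_compact)
  \<comment> \<open>\<open>A\<close> is bounded only on compact subsets of \<open>G\<close>. Cut off
    to the \<open>e0\<close>-neighbourhood \<open>K1\<close> of \<open>K\<close> it is integrable on
    the whole space, and bumps centred in \<open>K\<close> of radius at most \<open>e0\<close> do
    not notice the cut.\<close>
  define B where "B x = indicator K1 x *\<^sub>R A x" for x
  have [measurable]: "B \<in> borel_measurable borel" unfolding B_def[abs_def] by measurable
  have B_0: "x \<notin> K1 \<Longrightarrow> B x = 0" for x by (simp add: B_def)
  obtain M where M: "\<And>x. norm (B x) \<le> M" "M \<ge> 0"
  proof -
    obtain M where "\<And>x. x \<in> K1 \<Longrightarrow> norm (A x) \<le> M"
      using bdd[OF cK1 K1(1)] unfolding bounded_iff by auto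
    then have "norm (B x) \<le> max M 0" for x by (fastforce simp: B_def indicator_def)
    then show ?thesis using that by (meson max.cobounded2)
  qed
  have intB: "integrable lborel (\<lambda>x. norm (B x))"
    by (rule integrableI_bounded_set[where A = K1 and B = M])
      (use M emeasure_compact_finite[OF cK1] in \<open>auto simp: B_0\<close>)
  have cont\<eta>: "continuous_on UNIV \<eta>"
    using \<eta> unfolding gderiv_def by (auto intro!: has_derivative_continuous_on intro: has_derivative_at_withinI)
  have [measurable]: "\<eta> \<in> borel_measurable borel" "g \<in> borel_measurable borel"
    using cont\<eta> cont by (auto intro: borel_measurable_continuous_onI)
  have [measurable]: "(bump \<epsilon> :: 'a \<Rightarrow> real) \<in> borel_measurable borel"
      "(grad_bump \<epsilon> :: 'a \<Rightarrow> 'a) \<in> borel_measurable borel" for \<epsilon>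
    by (auto intro!: borel_measurable_continuous_onI continuous_intros)
  have intBg: "integrable lborel (\<lambda>x. B x \<bullet> g x)"
  proof -
    obtain Mg where Mg: "\<And>x. x \<in> K \<Longrightarrow> norm (g x) \<le> Mg"
      using compact_imp_bounded[OF compact_continuous_image[OF continuous_on_subset[OF cont] K(1)]]
      unfolding bounded_iff by auto
    have "norm (B x \<bullet> g x) \<le> M * max Mg 0" for x
    proof -
      have "norm (g x) \<le> max Mg 0" using Mg K(4) by (cases "x \<in> K") fastforce+
      then have "norm (B x) * norm (g x) \<le> M * max Mg 0"
        using M by (intro mult_mono) auto
      then show ?thesis using Cauchy_Schwarz_ineq2[of "B x" "g x"] by simp
    qed
    then show ?thesis
      by (intro integrableI_bounded_set[where A = K1 and B = "M * max Mg 0"])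
        (use emeasure_compact_finite[OF cK1] in \<open>auto simp: B_0\<close>)
  qed

  \<comment> \<open>\<open>\<omega>\<close> bounds the oscillation of \<open>g\<close> at the
    mollification scale. The mollified field pairs to 0 with \<open>B\<close>, so passing to
    \<open>g\<close> costs at most \<open>\<omega>\<close> times the L^1 norm of \<open>B\<close>;
    the mass \<open>m\<close> cancels.\<close>
  have bound: "\<bar>LINT x|lborel. B x \<bullet> g x\<bar> \<le> \<omega> * (LINT x|lborel. norm (B x))" if "\<omega> > 0" for \<omega>
  proof -
    obtain \<epsilon> where \<epsilon>: "\<epsilon> > 0" "\<epsilon> \<le> e0" "\<And>x y. norm (x - y) < \<epsilon> \<Longrightarrow> norm (g y - g x) \<le> \<omega>"
    proof -
      have "uniformly_continuous_on K1 g"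
        using cK1 cont by (auto intro: compact_uniformly_continuous continuous_on_subset)
      then obtain d where d: "d > 0" "\<And>x y. x \<in> K1 \<Longrightarrow> y \<in> K1 \<Longrightarrow> dist y x < d \<Longrightarrow> dist (g y) (g x) < \<omega>"
        using \<open>\<omega> > 0\<close> unfolding uniformly_continuous_on_def by metis
      have "norm (g y - g x) \<le> \<omega>" if xy: "norm (x - y) < min d e0" for x y
      proof (cases "x \<in> K \<or> y \<in> K")
        case True
        then have "x \<in> K1 \<and> y \<in> K1"
          using xy e0(1) unfolding K1_cball by (fastforce simp: dist_norm norm_minus_commute)
        then show ?thesis using d(2)[of x y] xy by (simp add: dist_norm norm_minus_commute)
      next
        case False
        then show ?thesis using K(4) \<open>\<omega> > 0\<close> by simp
      qed
      then show ?thesis using that[of "min d e0"] d(1) e0(1) by auto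
    qed
    define m where "m = (LINT v|lborel. bump \<epsilon> (v::'a))"
    define F where "F x y = \<eta> y * (B x \<bullet> grad_bump \<epsilon> (x - y))" for x y
    define H where "H x = (LINT y|lborel. F x y)" for x
    have bump_commute: "bump \<epsilon> (x - y) = bump \<epsilon> (y - x)"
      and grad_bump_commute: "grad_bump \<epsilon> (y - x) = - grad_bump \<epsilon> (x - y)" for x y :: 'a
      by (simp_all add: bump_def grad_bump_def inner_diff algebra_simps inner_commute)

    have int_bump0: "integrable lborel (bump \<epsilon> :: 'a \<Rightarrow> real)"
      by (rule integrable_compact_support[where K = "cball 0 \<epsilon>"])
        (auto intro!: continuous_intros bump_eq_0[OF \<epsilon>(1)])
    have int_bump: "integrable lborel (\<lambda>y. bump \<epsilon> (x - y))" for x :: 'a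
      using lborel_integrable_translate[OF int_bump0, of "- x"] by (simp add: bump_commute[of x])
    have m_eq: "(LINT y|lborel. bump \<epsilon> (x - y)) = m" for x :: 'a
      using lborel_integral_translate[of "bump \<epsilon>" "- x"] by (simp add: m_def bump_commute[of x])
    have m_pos: "m > 0"
    proof -
      have "m \<noteq> 0"
      proof
        assume "m = 0"
        then have "AE v in lborel. bump \<epsilon> (v::'a) = 0"
          unfolding m_def using integral_nonneg_eq_0_iff_AE[OF int_bump0] bump_nonneg by auto
        then have "AE v in lborel. v \<notin> ball (0::'a) \<epsilon>"
          by eventually_elim (use bump_pos in \<open>fastforce simp: dist_norm\<close>)
        then have "emeasure lborel (ball (0::'a) \<epsilon>) = 0"
          by (subst (asm) AE_iff_measurable[OF _ refl]) (auto simp: ball_def dist_norm)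
        then show False
          using \<epsilon>(1) unit_ball_vol_pos[of "real DIM('a)"] by (simp add: emeasure_ball)
      qed
      moreover have "m \<ge> 0" unfolding m_def by (intro integral_nonneg_AE) (simp add: bump_nonneg)
      ultimately show ?thesis by simp
    qed

    have F_int: "integrable (lborel \<Otimes>\<^sub>M lborel) (\<lambda>(x, y). F x y)"
    proof -
      obtain c1 where c1: "\<And>y. y \<in> K \<Longrightarrow> norm (\<eta> y) \<le> c1"
        using compact_imp_bounded[OF compact_continuous_image[OF continuous_on_subset[OF cont\<eta>] K(1)]]
        unfolding bounded_iff by auto
      have "continuous_on (cball 0 \<epsilon>) (\<lambda>v::'a. grad_bump \<epsilon> v)"
        by (intro continuous_intros)
      from compact_imp_bounded[OF compact_continuous_image[OF this compact_cball]]
      obtain c2 where c2: "\<And>v. v \<in> cball 0 \<epsilon> \<Longrightarrow> norm (grad_bump \<epsilon> (v::'a)) \<le> c2"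
        unfolding bounded_iff by blast
      have c: "norm (\<eta> y) \<le> max c1 0" "norm (grad_bump \<epsilon> v) \<le> max c2 0" for y v :: 'a
        using c1[of y] K(3)[of y] c2[of v] grad_bump_eq_0[OF \<epsilon>(1), of v] by fastforce+
      have "norm (F x y) \<le> max c1 0 * (M * max c2 0)" for x y
      proof -
        have "norm (B x) * norm (grad_bump \<epsilon> (x - y)) \<le> M * max c2 0"
          using M c by (intro mult_mono) auto
        then have "norm (B x \<bullet> grad_bump \<epsilon> (x - y)) \<le> M * max c2 0"
          using Cauchy_Schwarz_ineq2[of "B x" "grad_bump \<epsilon> (x - y)"] by simp
        then show ?thesis
          unfolding F_def norm_mult using c M(2) by (intro mult_mono) auto
      qed
      moreover have "F x y = 0" if "(x, y) \<notin> K1 \<times> K" for x y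
        using that B_0 K(3) by (auto simp: F_def)
      moreover have "(\<lambda>(x, y). F x y) \<in> borel_measurable (lborel \<Otimes>\<^sub>M lborel)"
        unfolding F_def split_beta' by measurable
      ultimately show ?thesis
        unfolding lborel_prod
        by (intro integrableI_bounded_set[where A = "K1 \<times> K" and B = "max c1 0 * (M * max c2 0)"])
          (use emeasure_compact_finite[OF compact_Times[OF cK1 K(1)]] in
            \<open>auto intro!: AE_I2 simp: borel_compact compact_Times cK1 K(1)\<close>)
    qed

    have intH: "integrable lborel H"
      unfolding H_def using lborel_pair.integrable_fst'[OF F_int] by simp
    \<comment> \<open>This is \<open>\<eta> y\<close> times the weak form for the bump at
      \<open>y\<close>. For \<open>y\<close> outside \<open>K\<close>, where that bump may not be
      admissible, the factor \<open>\<eta> y\<close> vanishes.\<close>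
    have "(LINT x|lborel. F x y) = 0" for y
    proof (cases "y \<in> K")
      case True
      have sub: "cball y \<epsilon> \<subseteq> K1"
        using True \<epsilon>(2) unfolding K1_cball by (meson UN_upper subset_cball subset_trans)
      then have "test_function G (\<lambda>x. bump \<epsilon> (x - y))"
        using K1(1) \<epsilon>(1) by (intro test_function_bump) auto
      from weak[OF this] have "(LINT x:G|lborel. A x \<bullet> grad_bump \<epsilon> (x - y)) = 0"
        by (simp add: grad_eqI[OF GDERIV_bump])
      moreover have "indicator G x *\<^sub>R (A x \<bullet> grad_bump \<epsilon> (x - y)) = B x \<bullet> grad_bump \<epsilon> (x - y)" for x
      proof (cases "x \<in> K1")
        case False
        then have "x \<notin> cball y \<epsilon>" using sub by auto
        then have "grad_bump \<epsilon> (x - y) = 0"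
          using \<epsilon>(1) by (intro grad_bump_eq_0) (auto simp: dist_norm norm_minus_commute)
        then show ?thesis by simp
      qed (use K1(1) in \<open>auto simp: B_def\<close>)
      ultimately show ?thesis by (simp add: F_def set_lebesgue_integral_def)
    qed (simp add: F_def K(3))
    then have intH0: "integral\<^sup>L lborel H = 0"
      unfolding H_def using lborel_pair.Fubini_integral[OF F_int] by simp

    have H_close: "norm (m * (B x \<bullet> g x) - H x) \<le> m * \<omega> * norm (B x)" for x
    proof -
      have D: "GDERIV (\<lambda>y. \<eta> y * bump \<epsilon> (x - y)) y :>
          bump \<epsilon> (x - y) *\<^sub>R g y - \<eta> y *\<^sub>R grad_bump \<epsilon> (x - y)" for y
        using GDERIV_mult[OF \<eta>[of y] GDERIV_bump[of \<epsilon> x y]]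
        by (simp add: bump_commute[of _ x] grad_bump_commute[of y x])
      \<comment> \<open>With \<open>x\<close> fixed, \<open>B x\<close> is a constant direction, in
        which the derivative of \<open>\<eta> y * bump \<epsilon> (x - y)\<close> with respect to
        \<open>y\<close> integrates to 0. This moves the derivative from the bump to
        \<open>\<eta>\<close>.\<close>
      have "(LINT y|lborel. B x \<bullet> (bump \<epsilon> (x - y) *\<^sub>R g y - \<eta> y *\<^sub>R grad_bump \<epsilon> (x - y))) = 0"
        by (rule integral_directional_derivative_eq_0[OF D _ K(1)])
          (use K in \<open>auto intro!: continuous_intros cont cont\<eta>\<close>)
      moreover have i1: "integrable lborel (\<lambda>y. bump \<epsilon> (x - y) * (B x \<bullet> g y))"
        by (rule integrable_compact_support[OF _ K(1)])
          (use K in \<open>auto intro!: continuous_intros cont\<close>)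
      moreover have "integrable lborel (F x)"
        unfolding F_def[abs_def] by (rule integrable_compact_support[OF _ K(1)])
          (use K in \<open>auto intro!: continuous_intros cont\<eta>\<close>)
      ultimately have H_eq: "H x = (LINT y|lborel. bump \<epsilon> (x - y) * (B x \<bullet> g y))"
        by (simp add: H_def F_def[abs_def] inner_diff_right)
      have i2: "integrable lborel (\<lambda>y. bump \<epsilon> (x - y) * (B x \<bullet> g x))"
        using int_bump by simp
      have "m * (B x \<bullet> g x) - H x = (LINT y|lborel. bump \<epsilon> (x - y) * (B x \<bullet> g x) - bump \<epsilon> (x - y) * (B x \<bullet> g y))"
        unfolding H_eq Bochner_Integration.integral_diff[OF i2 i1] by (simp add: m_eq)
      also have "norm \<dots> \<le> (LINT y|lborel. bump \<epsilon> (x - y) * (norm (B x) * \<omega>))"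
      proof (rule integral_norm_le_integral)
        show "norm (bump \<epsilon> (x - y) * (B x \<bullet> g x) - bump \<epsilon> (x - y) * (B x \<bullet> g y))
            \<le> bump \<epsilon> (x - y) * (norm (B x) * \<omega>)" for y
        proof (cases "norm (x - y) < \<epsilon>")
          case True
          have "norm (B x) * norm (g y - g x) \<le> norm (B x) * \<omega>"
            using \<epsilon>(3)[OF True] by (intro mult_left_mono) auto
          then have "\<bar>B x \<bullet> (g x - g y)\<bar> \<le> norm (B x) * \<omega>"
            using Cauchy_Schwarz_ineq2[of "B x" "g x - g y"] by (simp add: norm_minus_commute)
          then have "bump \<epsilon> (x - y) * \<bar>B x \<bullet> (g x - g y)\<bar> \<le> bump \<epsilon> (x - y) * (norm (B x) * \<omega>)"
            using bump_nonneg by (rule mult_left_mono)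
          then show ?thesis
            by (simp add: bump_nonneg abs_mult inner_diff_right flip: right_diff_distrib)
        next
          case False
          then show ?thesis using bump_eq_0[OF \<epsilon>(1), of "x - y"] by simp
        qed
      qed (use i1 i2 int_bump in auto)
      also have "\<dots> = m * \<omega> * norm (B x)"
        by (simp add: m_eq)
      finally show ?thesis .
    qed
    have "\<bar>m * (LINT x|lborel. B x \<bullet> g x)\<bar> = norm (LINT x|lborel. m * (B x \<bullet> g x) - H x)"
      using intBg intH by (simp add: intH0)
    also have "\<dots> \<le> (LINT x|lborel. m * \<omega> * norm (B x))"
      using H_close intB intBg intH by (intro integral_norm_le_integral) auto
    also have "\<dots> = m * (\<omega> * (LINT x|lborel. norm (B x)))" by simp
    finally show ?thesis using m_pos by (simp add: abs_mult)
  qed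
  have "\<bar>LINT x|lborel. B x \<bullet> g x\<bar> \<le> 0"
  proof (rule field_le_epsilon)
    fix e :: real assume "e > 0"
    define N where "N = (LINT x|lborel. norm (B x))"
    have N: "N \<ge> 0" unfolding N_def by simp
    \<comment> \<open>The summand 1 covers \<open>N = 0\<close>.\<close>
    have "e / (N + 1) * N \<le> e" using N \<open>e > 0\<close> by (simp add: field_simps)
    then show "\<bar>LINT x|lborel. B x \<bullet> g x\<bar> \<le> 0 + e"
      using bound[of "e / (N + 1)"] N \<open>e > 0\<close> unfolding N_def[symmetric] by simp
  qed
  moreover have "B x \<bullet> g x = A x \<bullet> g x" for x
    using K(4) K1(2) by (cases "x \<in> K") (auto simp: B_def)
  ultimately show ?thesis by simp
qed

section \<open>Solutions vanishing on a sphere\<close>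

text \<open>\<open>grad\<close> is a definite description, so a gradient must be exhibited: the
  linear derivative is represented by the vector of its values on the basis.\<close>

lemma differentiable_imp_GDERIV:
  fixes f :: "'a::euclidean_space \<Rightarrow> real"
  assumes "f differentiable (at x)"
  shows "GDERIV f x :> grad f x"
proof -
  obtain f' where f': "(f has_derivative f') (at x)"
    using assms unfolding differentiable_def by blast
  have lin: "linear f'" using f' by (rule has_derivative_linear)
  have "f' = (\<lambda>h. h \<bullet> (\<Sum>e\<in>Basis. f' e *\<^sub>R e))"
  proof
    fix h
    have "f' h = f' (\<Sum>e\<in>Basis. (h \<bullet> e) *\<^sub>R e)" by (simp add: euclidean_representation)
    also have "\<dots> = h \<bullet> (\<Sum>e\<in>Basis. f' e *\<^sub>R e)"
      by (simp add: linear_sum[OF lin] linear_cmul[OF lin] inner_sum_right mult.commute)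
    finally show "f' h = h \<bullet> (\<Sum>e\<in>Basis. f' e *\<^sub>R e)" .
  qed
  then have "GDERIV f x :> (\<Sum>e\<in>Basis. f' e *\<^sub>R e)"
    using f' unfolding gderiv_def by simp
  then show ?thesis using grad_eqI by metis
qed

lemma
  assumes "Ck_on 1 G f"
  shows Ck_on_1_GDERIV: "x \<in> G \<Longrightarrow> GDERIV f x :> grad f x"
    and Ck_on_1_continuous_grad: "continuous_on G (grad f)"
  using assms by (auto intro: differentiable_imp_GDERIV simp: continuous_on_componentwise[where f = "grad f"])

lemma Ck_on_1_continuous:
  assumes "Ck_on 1 G f"
  shows "continuous_on G f"
  using Ck_on_1_GDERIV[OF assms] unfolding gderiv_def
  by (auto intro!: has_derivative_continuous_on intro: has_derivative_at_withinI)

text \<open>The solution and its energy are defined with the completed measure, while Fubini and the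
  substitutions work over \<open>lborel\<close>. For Borel integrands the completion does not change
  the integral.\<close>

lemma set_lebesgue_integral_lborel:
  fixes f :: "'a::euclidean_space \<Rightarrow> real"
  assumes "(\<lambda>x. indicator G x *\<^sub>R f x) \<in> borel_measurable borel"
  shows "(LINT x:G|lebesgue. f x) = (LINT x:G|lborel. f x)"
  unfolding set_lebesgue_integral_def using assms by (intro integral_completion) simp

lemma p_laplace_weak_form_C1:
  fixes u \<eta> :: "'a::euclidean_space \<Rightarrow> real" and g :: "'a \<Rightarrow> 'a"
  assumes sol: "p_laplace_solution p G u" and "open G" and "1 < p"
    and \<eta>: "\<And>x. GDERIV \<eta> x :> g x" "continuous_on UNIV g"
    and K: "compact K" "K \<subseteq> G" "\<And>x. x \<notin> K \<Longrightarrow> \<eta> x = 0" "\<And>x. x \<notin> K \<Longrightarrow> g x = 0"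
  shows "(LINT x|lborel. (norm (grad u x) powr (p - 2)) * (grad u x \<bullet> g x)) = 0"
proof -
  have C1: "Ck_on 1 G u" using sol by (simp add: p_laplace_solution_def)
  \<comment> \<open>Nothing is known about \<open>grad u\<close> outside \<open>G\<close>; the
    cut-off makes it Borel on the whole space.\<close>
  define V where "V x = indicator G x *\<^sub>R grad u x" for x
  have [measurable]: "V \<in> borel_measurable borel"
    unfolding V_def[abs_def] using \<open>open G\<close> Ck_on_1_continuous_grad[OF C1]
    by (intro borel_measurable_continuous_on_indicator) auto
  define A where "A x = norm (V x) powr (p - 2) *\<^sub>R V x" for x
  have [measurable]: "A \<in> borel_measurable borel" unfolding A_def[abs_def] by measurable
  have [measurable]: "G \<in> sets borel" using \<open>open G\<close> by simp
  have "(LINT x|lborel. A x \<bullet> g x) = 0"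
  proof (rule weak_form_C1[OF \<open>open G\<close> _ _ _ \<eta> K])
    fix L assume L: "compact L" "L \<subseteq> G"
    obtain c where c: "\<And>x. x \<in> L \<Longrightarrow> norm (grad u x) \<le> c"
      using compact_imp_bounded[OF compact_continuous_image[OF
          continuous_on_subset[OF Ck_on_1_continuous_grad[OF C1] L(2)] L(1)]]
      unfolding bounded_iff by auto
    have "norm (A x) \<le> c powr (p - 1)" if "x \<in> L" for x
    proof -
      \<comment> \<open>For p < 2 the scalar factor blows up near zeros of the gradient, but the
        field has norm |grad u|^(p-1), which is locally bounded since p > 1.\<close>
      have "norm (A x) = norm (grad u x) powr (p - 1)"
        using that L(2) powr_mult_base[of "norm (grad u x)" "p - 2"]
        by (auto simp: A_def V_def mult.commute)
      also have "\<dots> \<le> c powr (p - 1)"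
        using c[OF that] \<open>1 < p\<close> by (intro powr_mono2) auto
      finally show ?thesis .
    qed
    then show "bounded (A ` L)" unfolding bounded_iff by auto
  next
    fix \<phi> :: "'a \<Rightarrow> real" assume \<phi>: "test_function G \<phi>"
    then have "continuous_on UNIV (grad \<phi>)"
      unfolding test_function_def using Ck_on_1_continuous_grad by blast
    then have [measurable]: "grad \<phi> \<in> borel_measurable borel"
      by (rule borel_measurable_continuous_onI)
    have "(LINT x:G|lborel. A x \<bullet> grad \<phi> x) = (LINT x:G|lebesgue. A x \<bullet> grad \<phi> x)"
      by (intro set_lebesgue_integral_lborel[symmetric]) measurable
    also have "\<dots> = (LINT x:G|lebesgue. ((norm (grad u x) powr (p - 2)) *\<^sub>R grad u x) \<bullet> grad \<phi> x)"
      unfolding set_lebesgue_integral_def by (rule Bochner_Integration.integral_cong) (auto simp: A_def V_def indicator_def)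
    also have "\<dots> = 0" using sol \<phi> by (simp add: p_laplace_solution_def)
    finally show "(LINT x:G|lborel. A x \<bullet> grad \<phi> x) = 0" .
  qed fact
  moreover have "A x \<bullet> g x = (norm (grad u x) powr (p - 2)) * (grad u x \<bullet> g x)" for x
    using K(2,4) by (cases "x \<in> K") (auto simp: A_def V_def)
  ultimately show ?thesis by simp
qed

text \<open>At 0 the difference quotient is \<open>max 0 h\<close>, which tends to 0: the square
  removes the kink of the positive part.\<close>

lemma has_real_derivative_max_0_power2:
  "((\<lambda>s. (max 0 s)\<^sup>2) has_real_derivative 2 * max 0 s) (at (s::real))"
proof -
  consider "s > 0" | "s < 0" | "s = 0" by linarith
  then show ?thesis
  proof cases
    case 1
    have "((\<lambda>s. s\<^sup>2) has_real_derivative 2 * max 0 s) (at s)"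
      using 1 by (auto intro!: derivative_eq_intros)
    then show ?thesis
      by (rule has_field_derivative_transform_within_open[where S = "{0<..}"]) (use 1 in auto)
  next
    case 2
    have "((\<lambda>s. 0) has_real_derivative 2 * max 0 s) (at s)"
      using 2 by simp
    then show ?thesis
      by (rule has_field_derivative_transform_within_open[where S = "{..<0}"]) (use 2 in auto)
  next
    case 3
    have "((\<lambda>h. max 0 h) \<longlongrightarrow> max 0 0) (at (0::real))"
      by (intro tendsto_intros)
    then have "((\<lambda>h. (max 0 h)\<^sup>2 / h) \<longlongrightarrow> 0) (at (0::real))"
      by (auto elim!: Lim_transform_eventually simp: eventually_at_filter max_def power2_eq_square)
    then show ?thesis using 3 by (simp add: DERIV_def)
  qed
qed

text \<open>The set where \<open>h\<close> is nonzero is open and null, hence empty.\<close>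

lemma continuous_nonneg_integral_0_imp_0:
  fixes h :: "'a::euclidean_space \<Rightarrow> real"
  assumes "continuous_on UNIV h" "integrable lborel h" "\<And>x. h x \<ge> 0" "integral\<^sup>L lborel h = 0"
  shows "h x = 0"
proof -
  have "AE x in lborel. h x = 0"
    using assms integral_nonneg_eq_0_iff_AE by (metis AE_I2)
  moreover have op: "open {x. h x \<noteq> 0}"
    using assms(1) by (intro open_Collect_neq continuous_intros)
  ultimately have "emeasure lborel {x. h x \<noteq> 0} = 0"
    by (subst (asm) AE_iff_measurable[OF _ refl]) auto
  then have "negligible {x. h x \<noteq> 0}"
    using op by (auto simp: negligible_iff_null_sets null_sets_def)
  then show ?thesis using open_not_negligible[OF op] by auto
qed

text \<open>Test with \<open>\<phi> \<circ> u\<close> on the ball, where \<open>\<phi> s = (s - \<epsilon>)\<^sub>+\<^sup>2 - (- s - \<epsilon>)\<^sub>+\<^sup>2\<close>: the equation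
  says that \<open>\<phi>' u * \<bar>\<nabla>u\<bar>\<^sup>p\<close> has integral \<open>0\<close>, so \<open>\<phi> \<circ> u\<close> is constant.\<close>

lemma p_laplace_zero_boundary:
  fixes u :: "'a::euclidean_space \<Rightarrow> real"
  assumes sol: "p_laplace_solution p G u" and "open G" and "1 < p" and "0 < r"
    and sub: "cball z r \<subseteq> G" and zero: "\<And>x. x \<in> sphere z r \<Longrightarrow> u x = 0"
    and x: "x \<in> ball z r"
  shows "u x = 0"
proof -
  have C1: "Ck_on 1 G u" using sol by (simp add: p_laplace_solution_def)
  note Du = Ck_on_1_GDERIV[OF C1] and cDu = Ck_on_1_continuous_grad[OF C1] and cu = Ck_on_1_continuous[OF C1]
  have ballG: "ball z r \<subseteq> G" using sub by auto
  have "\<bar>u x\<bar> \<le> \<epsilon>" if "\<epsilon> > 0" for \<epsilon>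
  proof -
    \<comment> \<open>The odd form treats both signs of \<open>u\<close> at once and keeps the
      derivative nonnegative, so that the integrand \<open>h\<close> below has a sign.\<close>
    define \<phi> where "\<phi> s = (max 0 (s - \<epsilon>))\<^sup>2 - (max 0 (- s - \<epsilon>))\<^sup>2" for s
    define \<phi>' where "\<phi>' s = 2 * max 0 (s - \<epsilon>) + 2 * max 0 (- s - \<epsilon>)" for s
    have D\<phi>: "(\<phi> has_real_derivative \<phi>' s) (at s)" for s
    proof -
      have "((\<lambda>s. (max 0 (s - \<epsilon>))\<^sup>2) has_real_derivative 2 * max 0 (s - \<epsilon>) * 1) (at s)"
        by (rule DERIV_chain2[OF has_real_derivative_max_0_power2]) (auto intro!: derivative_eq_intros)
      moreover have "((\<lambda>s. (max 0 (- s - \<epsilon>))\<^sup>2) has_real_derivative 2 * max 0 (- s - \<epsilon>) * (-1)) (at s)"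
        by (rule DERIV_chain2[OF has_real_derivative_max_0_power2]) (auto intro!: derivative_eq_intros)
      ultimately show ?thesis
        unfolding \<phi>_def[abs_def] \<phi>'_def by (drule_tac DERIV_diff) auto
    qed
    have \<phi>0: "\<phi> s = 0" "\<phi>' s = 0" if "\<bar>s\<bar> \<le> \<epsilon>" for s using that by (auto simp: \<phi>_def \<phi>'_def)
    have \<phi>'_nonneg: "\<phi>' s \<ge> 0" for s by (simp add: \<phi>'_def)
    have c\<phi>': "continuous_on S \<phi>'" for S unfolding \<phi>'_def[abs_def] by (intro continuous_intros)
    define \<eta> where "\<eta> x = (if x \<in> ball z r then \<phi> (u x) else 0)" for x
    define g where "g x = (if x \<in> ball z r then \<phi>' (u x) *\<^sub>R grad u x else 0)" for x
    define h where "h x = (if x \<in> ball z r then \<phi>' (u x) * norm (grad u x) powr p else 0)" for x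
    \<comment> \<open>The points of the closed ball with |u| at least \<open>\<epsilon>\<close>. As
      \<open>u\<close> is 0 on the sphere, this closed set lies in the open ball, which gives the
      compact support.\<close>
    define K where "K = cball z r \<inter> u -` ({..-\<epsilon>} \<union> {\<epsilon>..})"
    have "closed K" unfolding K_def
      using continuous_on_subset[OF cu sub] by (intro continuous_closed_preimage) auto
    then have K: "compact K"
      using compact_Int_closed[OF compact_cball, of K z r] by (simp add: K_def Int_assoc[symmetric])
    have K_ball: "K \<subseteq> ball z r"
    proof
      fix y assume "y \<in> K"
      moreover have "y \<notin> sphere z r" using zero[of y] \<open>y \<in> K\<close> \<open>\<epsilon> > 0\<close> by (auto simp: K_def)
      ultimately show "y \<in> ball z r" by (auto simp: K_def)
    qed
    have off_K: "\<eta> y = 0" "g y = 0" "h y = 0" if "y \<notin> K" for y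
      using that \<phi>0[of "u y"] by (auto simp: \<eta>_def g_def h_def K_def)
    \<comment> \<open>Two open sets that cover the space: on the ball \<open>\<eta>\<close>,
      \<open>g\<close> and \<open>h\<close> are given by their formulas, off \<open>K\<close> they
      are 0. Differentiability and continuity are checked on each.\<close>
    have cover: "ball z r \<union> - K = UNIV" using K_ball by auto
    have op: "open (ball z r)" "open (- K)" using \<open>closed K\<close> by auto
    have D\<eta>: "GDERIV \<eta> y :> g y" for y
    proof (cases "y \<in> ball z r")
      case True
      have "GDERIV (\<lambda>x. \<phi> (u x)) y :> \<phi>' (u y) *\<^sub>R grad u y"
        using Du D\<phi> True ballG by (intro GDERIV_DERIV_compose) auto
      then show ?thesis
        unfolding gderiv_def
        by (rule has_derivative_transform_within_open[OF _ op(1) True, THEN has_derivative_eq_rhs])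
          (use True in \<open>auto simp: \<eta>_def g_def\<close>)
    next
      case False
      then have yK: "y \<in> - K" using K_ball by auto
      have "GDERIV (\<lambda>x. 0) y :> 0" by (rule GDERIV_const)
      then show ?thesis
        unfolding gderiv_def
        by (rule has_derivative_transform_within_open[OF _ op(2) yK, THEN has_derivative_eq_rhs])
          (use yK off_K in auto)
    qed
    have "continuous_on (ball z r \<union> - K) g"
    proof (rule continuous_on_open_Un[OF op])
      have "continuous_on (ball z r) (\<lambda>x. \<phi>' (u x) *\<^sub>R grad u x)"
        by (intro continuous_intros continuous_on_compose2[OF c\<phi>'[of UNIV]]
            continuous_on_subset[OF cu ballG] continuous_on_subset[OF cDu ballG]) auto
      then show "continuous_on (ball z r) g"
        by (rule continuous_on_eq) (simp add: g_def)
      show "continuous_on (- K) g"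
        by (rule continuous_on_eq[of _ "\<lambda>x. 0"]) (use off_K in auto)
    qed
    then have cg: "continuous_on UNIV g" unfolding cover .
    have "continuous_on (ball z r \<union> - K) h"
    proof (rule continuous_on_open_Un[OF op])
      have "continuous_on (ball z r) (\<lambda>x. \<phi>' (u x) * norm (grad u x) powr p)"
        using \<open>1 < p\<close> by (intro continuous_intros continuous_on_compose2[OF c\<phi>'[of UNIV]] continuous_on_powr'
            continuous_on_subset[OF cu ballG] continuous_on_subset[OF cDu ballG]) auto
      then show "continuous_on (ball z r) h"
        by (rule continuous_on_eq) (simp add: h_def)
      show "continuous_on (- K) h"
        by (rule continuous_on_eq[of _ "\<lambda>x. 0"]) (use off_K in auto)
    qed
    then have ch: "continuous_on UNIV h" unfolding cover .
    have h_eq: "norm (grad u y) powr (p - 2) * (grad u y \<bullet> g y) = h y" for y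
    proof -
      have "norm (grad u y) powr (p - 2) * (norm (grad u y))\<^sup>2 = norm (grad u y) powr p"
        by (cases "grad u y = 0") (auto simp: powr_diff field_simps)
      then show ?thesis by (simp add: g_def h_def dot_square_norm)
    qed
    have "integral\<^sup>L lborel h = 0"
      using p_laplace_weak_form_C1[OF sol \<open>open G\<close> \<open>1 < p\<close> D\<eta> cg K _ off_K(1,2)] K_ball ballG
      unfolding h_eq by auto
    moreover have "h y \<ge> 0" for y by (simp add: h_def \<phi>'_nonneg)
    ultimately have h0: "h y = 0" for y
      by (intro continuous_nonneg_integral_0_imp_0[OF ch integrable_compact_support[OF ch K off_K(3)]])
    \<comment> \<open>Where \<open>h\<close> vanishes in the ball, \<open>\<phi>' (u y)\<close> or
      the gradient of \<open>u\<close> vanishes, and either makes \<open>g\<close> zero.\<close>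
    have "g y = 0" for y
      using h0[of y] by (auto simp: g_def h_def split: if_splits)
    then have "\<exists>c. \<forall>y\<in>UNIV. \<eta> y = c"
      using D\<eta> by (intro has_derivative_zero_constant) (auto simp: gderiv_def)
    then obtain c where c: "\<And>y. \<eta> y = c" by auto
    \<comment> \<open>A point of the sphere is outside the open ball, so the constant value of
      \<open>\<eta>\<close> is 0.\<close>
    have "\<eta> (z + r *\<^sub>R (SOME e. e \<in> Basis)) = 0"
      using \<open>0 < r\<close> by (simp add: \<eta>_def dist_norm SOME_Basis)
    then have "\<phi> (u x) = 0" using c x unfolding \<eta>_def by metis
    have "\<phi> s > 0" if "s > \<epsilon>" for s
      using that \<open>\<epsilon> > 0\<close> by (simp add: \<phi>_def max_def)
    moreover have "\<phi> s < 0" if "s < - \<epsilon>" for s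
      using that \<open>\<epsilon> > 0\<close> by (simp add: \<phi>_def max_def)
    ultimately show ?thesis
      using \<open>\<phi> (u x) = 0\<close> by (metis abs_leI linorder_not_le minus_le_iff less_irrefl)
  qed
  then have "\<bar>u x\<bar> \<le> 0" by (rule field_le_epsilon) simp
  then show ?thesis by simp
qed

section \<open>Radial integration\<close>

abbreviation radial_proj :: "'a::euclidean_space \<Rightarrow> real \<Rightarrow> 'a \<Rightarrow> 'a" where
  "radial_proj z s x \<equiv> z + (s / norm (x - z)) *\<^sub>R (x - z)"

lemma radial_proj_in_sphere:
  "x \<noteq> z \<Longrightarrow> r > 0 \<Longrightarrow> radial_proj z r x \<in> sphere z r"
  by (simp add: dist_norm)

lemma nn_integral_sphere_measure:
  fixes f :: "'a::euclidean_space \<Rightarrow> ennreal"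
  assumes [measurable]: "f \<in> borel_measurable borel"
  shows "(\<integral>\<^sup>+x. f x \<partial>sphere_measure z r) =
    ennreal (real DIM('a) / r) *
      (\<integral>\<^sup>+x. f (radial_proj z r x) * indicator (ball z r - {z}) x \<partial>lborel)"
proof -
  have [measurable]: "radial_proj z r \<in> restrict_space lborel (ball z r - {z}) \<rightarrow>\<^sub>M borel"
    by (intro measurable_restrict_space1) measurable
  have "(\<integral>\<^sup>+x. f x \<partial>sphere_measure z r) = ennreal (real DIM('a) / r) *
      (\<integral>\<^sup>+x. f x \<partial>distr (restrict_space lborel (ball z r - {z})) borel (radial_proj z r))"
    unfolding sphere_measure_def by (rule nn_integral_scale_measure) simp
  also have "(\<integral>\<^sup>+x. f x \<partial>distr (restrict_space lborel (ball z r - {z})) borel (radial_proj z r)) =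
      (\<integral>\<^sup>+x. f (radial_proj z r x) \<partial>restrict_space lborel (ball z r - {z}))"
    by (intro nn_integral_distr) measurable
  also have "\<dots> = (\<integral>\<^sup>+x. f (radial_proj z r x) * indicator (ball z r - {z}) x \<partial>lborel)"
    by (intro nn_integral_restrict_space) auto
  finally show ?thesis .
qed

text \<open>The Bochner integral is 0 by default for a non-integrable function, so integrability
  comes before the passage to the nonnegative integral; it follows from boundedness on the compact
  sphere and finite surface area.\<close>

lemma ennreal_sphere_integral:
  fixes u :: "'a::euclidean_space \<Rightarrow> real"
  assumes u: "continuous_on (sphere z r) u" and "r > 0" "p > 0"
  shows "ennreal (sphere_integral p u z r) = ennreal (real DIM('a) / r) *
    (\<integral>\<^sup>+x. ennreal (\<bar>u (radial_proj z r x)\<bar> powr p) * indicator (ball z r - {z}) x \<partial>lborel)"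
proof -
  define f where "f y = indicator (sphere z r) y *\<^sub>R (\<bar>u y\<bar> powr p)" for y
  have f_nonneg: "f y \<ge> 0" for y by (simp add: f_def)
  have cont: "continuous_on (sphere z r) (\<lambda>y. \<bar>u y\<bar> powr p)"
    using u \<open>p > 0\<close> by (intro continuous_on_powr' continuous_intros) auto
  then have [measurable]: "f \<in> borel_measurable borel"
    unfolding f_def[abs_def] by (intro borel_measurable_continuous_on_indicator) auto
  obtain c where c: "\<And>y. y \<in> sphere z r \<Longrightarrow> norm (\<bar>u y\<bar> powr p) \<le> c"
    using compact_imp_bounded[OF compact_continuous_image[OF cont compact_sphere]]
    unfolding bounded_iff by blast
  have [measurable]: "f \<in> borel_measurable (sphere_measure z r)"
    unfolding measurable_cong_sets[OF sets_sphere_measure refl] by measurable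
  have "emeasure (sphere_measure z r) (sphere z r) < \<infinity>"
    by (simp add: emeasure_sphere_measure_sphere[OF \<open>r > 0\<close>])
  then have "integrable (sphere_measure z r) f"
    using c by (intro integrableI_bounded_set[where A = "sphere z r" and B = c])
      (auto intro!: AE_I2, auto simp: f_def)
  then have "ennreal (sphere_integral p u z r) = (\<integral>\<^sup>+y. ennreal (f y) \<partial>sphere_measure z r)"
    unfolding sphere_integral_def set_lebesgue_integral_def f_def[symmetric]
    by (intro nn_integral_eq_integral[symmetric] AE_I2) (simp_all add: f_nonneg)
  also have "\<dots> = ennreal (real DIM('a) / r) *
      (\<integral>\<^sup>+x. ennreal (f (radial_proj z r x)) * indicator (ball z r - {z}) x \<partial>lborel)"
    by (intro nn_integral_sphere_measure) measurable
  also have "(\<integral>\<^sup>+x. ennreal (f (radial_proj z r x)) * indicator (ball z r - {z}) x \<partial>lborel) =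
    (\<integral>\<^sup>+x. ennreal (\<bar>u (radial_proj z r x)\<bar> powr p) * indicator (ball z r - {z}) x \<partial>lborel)"
    by (intro nn_integral_cong)
      (use radial_proj_in_sphere[OF _ \<open>r > 0\<close>, of _ z] in \<open>auto simp: f_def split: split_indicator\<close>)
  finally show ?thesis .
qed

text \<open>Extended constantly along rays, \<open>u\<close> is continuous on the punctured ball and
  vanishes almost everywhere there, hence everywhere, since a null open set is empty.\<close>

lemma sphere_integral_0_imp_0:
  fixes u :: "'a::euclidean_space \<Rightarrow> real"
  assumes u: "continuous_on (sphere z r) u" and "r > 0" "p > 0"
    and 0: "sphere_integral p u z r \<le> 0" and y: "y \<in> sphere z r"
  shows "u y = 0"
proof -
  let ?O = "ball z r - {z}"
  define k where "k x = u (radial_proj z r x)" for x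
  have contk: "continuous_on ?O k"
    unfolding k_def
    by (intro continuous_on_compose2[OF u] continuous_intros)
      (auto simp del: mem_sphere intro!: radial_proj_in_sphere \<open>r > 0\<close>)
  have "continuous_on ?O (\<lambda>x. \<bar>k x\<bar> powr p)"
    using contk \<open>p > 0\<close> by (intro continuous_on_powr' continuous_intros) auto
  then have "(\<lambda>x. indicator ?O x *\<^sub>R (\<bar>k x\<bar> powr p)) \<in> borel_measurable borel"
    by (intro borel_measurable_continuous_on_indicator) auto
  then have meas: "(\<lambda>x. ennreal (indicator ?O x *\<^sub>R (\<bar>k x\<bar> powr p))) \<in> borel_measurable lborel"
    by measurable
  have ind: "ennreal (indicator ?O x *\<^sub>R (\<bar>k x\<bar> powr p)) = ennreal (\<bar>k x\<bar> powr p) * indicator ?O x" for x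
    by (auto split: split_indicator)
  note meas = meas[unfolded ind]
  have "ennreal (real DIM('a) / r) * (\<integral>\<^sup>+x. ennreal (\<bar>k x\<bar> powr p) * indicator ?O x \<partial>lborel) = 0"
    using ennreal_sphere_integral[OF u \<open>r > 0\<close> \<open>p > 0\<close>] 0
    unfolding k_def by (simp add: ennreal_neg)
  then have "(\<integral>\<^sup>+x. ennreal (\<bar>k x\<bar> powr p) * indicator ?O x \<partial>lborel) = 0"
    using \<open>r > 0\<close> by (simp add: ennreal_eq_0_iff divide_le_0_iff)
  then have AE: "AE x in lborel. ennreal (\<bar>k x\<bar> powr p) * indicator ?O x = 0"
    using nn_integral_0_iff_AE[OF meas] by simp
  then have AE: "AE x in lborel. x \<notin> {x \<in> ?O. k x \<noteq> 0}"
    by eventually_elim (auto simp: indicator_def split: if_splits)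
  have "{x \<in> ?O. k x \<noteq> 0} = ?O \<inter> k -` (- {0})" by blast
  also have "open \<dots>" by (rule continuous_open_preimage[OF contk]) auto
  finally have op: "open {x \<in> ?O. k x \<noteq> 0}" .
  then have "{x \<in> ?O. k x \<noteq> 0} \<in> null_sets lborel"
    using AE by (subst AE_iff_null_sets) auto
  then have "negligible {x \<in> ?O. k x \<noteq> 0}"
    by (simp add: negligible_iff_null_sets null_sets_completionI)
  then have empty: "{x \<in> ?O. k x \<noteq> 0} = {}"
    using open_not_negligible[OF op] by auto
  have n: "norm (y - z) = r" using y by (simp add: dist_norm norm_minus_commute)
  \<comment> \<open>The midpoint of the radius to \<open>y\<close>, a point of the punctured ball
    that projects to \<open>y\<close>.\<close>
  define x where "x = z + (1/2) *\<^sub>R (y - z)"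
  have "x \<in> ?O" using n \<open>r > 0\<close> by (auto simp: x_def dist_norm)
  moreover have "radial_proj z r x = y" using n \<open>r > 0\<close> by (simp add: x_def)
  ultimately show ?thesis using empty by (auto simp: k_def)
qed

text \<open>Serves as the inner integral over \<open>t\<close> in the radial estimate; the open
  half-line is enlarged to a closed one to apply the fundamental theorem.\<close>

lemma nn_integral_inverse_power_le:
  assumes "c > 0" "n > 0"
  shows "(\<integral>\<^sup>+t. ennreal (inverse t ^ Suc n) * indicator {t. t > c} t \<partial>lborel) \<le> ennreal (inverse c ^ n / real n)"
proof -
  have "(\<integral>\<^sup>+t. ennreal (inverse t ^ Suc n) * indicator {t. t > c} t \<partial>lborel) \<le>
      (\<integral>\<^sup>+t. ennreal (inverse t ^ Suc n) * indicator {c..} t \<partial>lborel)"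
    by (intro nn_integral_mono) (auto split: split_indicator)
  also have "\<dots> = ennreal (0 - (- (inverse c ^ n / real n)))"
  proof (rule nn_integral_FTC_atLeast[where F = "\<lambda>t. - (inverse t ^ n / real n)"])
    show "((\<lambda>t. - (inverse t ^ n / real n)) has_real_derivative inverse x ^ Suc n) (at x)" if "c \<le> x" for x
    proof -
      have x: "x > 0" using that assms by simp
      obtain m where m: "n = Suc m" using assms(2) gr0_conv_Suc by auto
      have "((\<lambda>t. inverse t ^ n) has_real_derivative - real n * inverse x ^ Suc n) (at x)"
        using DERIV_power[OF DERIV_inverse[of x UNIV], of n] x unfolding m by (simp add: algebra_simps)
      from DERIV_minus[OF DERIV_cdivide[OF this, of "real n"]] show ?thesis
        using assms(2) by simp
    qed
    show "0 \<le> inverse x ^ Suc n" if "c \<le> x" for x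
      using that assms by simp
    have "((\<lambda>t. - (inverse t ^ n / real n)) \<longlongrightarrow> - (0 ^ n / real n)) at_top"
      by (intro tendsto_intros tendsto_inverse_0_at_top filterlim_ident) (use assms in auto)
    moreover have "- (0 ^ n / real n) = (0 :: real)" using assms by simp
    ultimately show "((\<lambda>t. - (inverse t ^ n / real n)) \<longlongrightarrow> 0) at_top" by (simp only:)
  qed measurable
  finally show ?thesis by simp
qed

text \<open>Half of the polar coordinate formula, from Tonelli's theorem alone: substitute
  \<open>s = t \<bar>x - z\<bar>\<close> in the radial integral, exchange, and substitute \<open>y = z + t (x - z)\<close>.\<close>

lemma nn_integral_radial_le:
  fixes w :: "'a::euclidean_space \<Rightarrow> ennreal"
  assumes w [measurable]: "w \<in> borel_measurable borel" and "0 < a" "0 < r"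
  shows "(\<integral>\<^sup>+x. (\<integral>\<^sup>+s. w (radial_proj z s x) * indicator {a..r} s \<partial>lborel) * indicator (ball z r - {z}) x \<partial>lborel)
    \<le> ennreal (r * (r / a) ^ (DIM('a) - 1) / real DIM('a)) * (\<integral>\<^sup>+y. w y \<partial>lborel)"
proof -
  let ?n = "DIM('a)"
  let ?O = "ball z r - {z}"
  \<comment> \<open>The factor \<open>norm (x - z)\<close> is the Jacobian of s = t |x - z|.\<close>
  define \<Psi> where "\<Psi> t x = w (z + t *\<^sub>R (x - z)) * indicator {a..r} (t * norm (x - z)) *
      ennreal (norm (x - z)) * indicator {0<..<r} (norm (x - z))" for t :: real and x
  \<comment> \<open>The substitution y = z + t (x - z) contributes t^(-n), and |x - z| = |y - z| / t
    one more power of 1/t. The condition |x - z| < r becomes t > |y - z| / r.\<close>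
  define \<Phi> where "\<Phi> t y = (w y * indicator {a..r} (norm (y - z)) * ennreal (norm (y - z))) *
      (ennreal (inverse t ^ Suc ?n) * indicator {t. t > norm (y - z) / r} t)" for t :: real and y
  have O_ind: "indicator ?O x = (indicator {0<..<r} (norm (x - z)) :: ennreal)" for x
    by (auto simp: indicator_def dist_norm norm_minus_commute)
  have [measurable]: "(\<lambda>(t, x). \<Psi> t x) \<in> borel_measurable (lborel \<Otimes>\<^sub>M lborel)"
    unfolding \<Psi>_def by measurable
  have [measurable]: "(\<lambda>(t, x). \<Phi> t x) \<in> borel_measurable (lborel \<Otimes>\<^sub>M lborel)"
    unfolding \<Phi>_def by measurable
  have "(\<integral>\<^sup>+x. (\<integral>\<^sup>+s. w (radial_proj z s x) * indicator {a..r} s \<partial>lborel) * indicator ?O x \<partial>lborel) =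
      (\<integral>\<^sup>+x. (\<integral>\<^sup>+t. \<Psi> t x \<partial>lborel) \<partial>lborel)"
  proof (rule nn_integral_cong)
    fix x :: 'a
    show "(\<integral>\<^sup>+s. w (radial_proj z s x) * indicator {a..r} s \<partial>lborel) * indicator ?O x = (\<integral>\<^sup>+t. \<Psi> t x \<partial>lborel)"
    proof (cases "x \<in> ?O")
      case True
      then have pos: "norm (x - z) > 0" by auto
      have "(\<integral>\<^sup>+s. w (radial_proj z s x) * indicator {a..r} s \<partial>lborel) =
          ennreal \<bar>norm (x - z)\<bar> * (\<integral>\<^sup>+t. w (radial_proj z (0 + norm (x - z) * t) x) * indicator {a..r} (0 + norm (x - z) * t) \<partial>lborel)"
        using pos by (intro nn_integral_real_affine) auto
      also have "\<dots> = (\<integral>\<^sup>+t. ennreal \<bar>norm (x - z)\<bar> * (w (radial_proj z (0 + norm (x - z) * t) x) * indicator {a..r} (0 + norm (x - z) * t)) \<partial>lborel)"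
        by (intro nn_integral_cmult[symmetric]) measurable
      also have "\<dots> = (\<integral>\<^sup>+t. \<Psi> t x \<partial>lborel)"
        using pos True by (intro nn_integral_cong) (simp add: \<Psi>_def mult_ac flip: O_ind)
      finally show ?thesis using True by simp
    qed (simp add: \<Psi>_def flip: O_ind)
  qed
  also have "\<dots> = (\<integral>\<^sup>+t. (\<integral>\<^sup>+x. \<Psi> t x \<partial>lborel) \<partial>lborel)"
    by (intro lborel_pair.Fubini') measurable
  also have "\<dots> \<le> (\<integral>\<^sup>+t. (\<integral>\<^sup>+y. \<Phi> t y \<partial>lborel) \<partial>lborel)"
  proof (rule nn_integral_mono)
    fix t :: real
    show "(\<integral>\<^sup>+x. \<Psi> t x \<partial>lborel) \<le> (\<integral>\<^sup>+y. \<Phi> t y \<partial>lborel)"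
    proof (cases "t > 0")
      case True
      define T where "T y = (z - inverse t *\<^sub>R z) + inverse t *\<^sub>R y" for y :: 'a
      have T: "T y - z = inverse t *\<^sub>R (y - z)" for y by (simp add: T_def algebra_simps)
      have [measurable]: "T \<in> borel \<rightarrow>\<^sub>M borel" unfolding T_def[abs_def] by measurable
      have "(\<integral>\<^sup>+x. \<Psi> t x \<partial>lborel) = (\<integral>\<^sup>+x. \<Psi> t x \<partial>density (distr lborel borel T) (\<lambda>_. ennreal (\<bar>inverse t\<bar> ^ ?n)))"
        unfolding T_def[abs_def] using True by (subst lborel_affine[symmetric]) auto
      also have "\<dots> = (\<integral>\<^sup>+y. ennreal (inverse t ^ ?n) * \<Psi> t (T y) \<partial>lborel)"
        using True by (simp add: nn_integral_density nn_integral_distr)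
      also have "\<dots> \<le> (\<integral>\<^sup>+y. \<Phi> t y \<partial>lborel)"
      proof (rule nn_integral_mono)
        fix y :: 'a
        have eq: "ennreal (inverse t ^ ?n) * ennreal (norm (T y - z)) =
            ennreal (norm (y - z)) * ennreal (inverse t ^ Suc ?n)"
          using True by (simp add: T mult_ac flip: ennreal_mult)
        have le: "indicator ?O (T y) \<le> (indicator {t. t > norm (y - z) / r} t :: ennreal)"
        proof (cases "T y \<in> ?O")
          case True
          then have "norm (T y - z) < r" by (simp add: dist_norm norm_minus_commute)
          then have "norm (y - z) / t < r"
            using \<open>t > 0\<close> unfolding T by (simp add: divide_inverse_commute)
          then have "norm (y - z) / r < t"
            using \<open>t > 0\<close> \<open>r > 0\<close> by (simp add: field_simps)
          then show ?thesis by (auto split: split_indicator)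
        qed simp
        have "t * norm (T y - z) = norm (y - z)" "z + t *\<^sub>R (T y - z) = y"
          using True by (simp_all add: T)
        then have "ennreal (inverse t ^ ?n) * \<Psi> t (T y) = (w y * indicator {a..r} (norm (y - z))) *
            (ennreal (inverse t ^ ?n) * ennreal (norm (T y - z))) * indicator ?O (T y)"
          unfolding \<Psi>_def O_ind[symmetric] by (simp add: mult_ac)
        also have "\<dots> \<le> (w y * indicator {a..r} (norm (y - z))) *
            (ennreal (norm (y - z)) * ennreal (inverse t ^ Suc ?n)) * indicator {t. t > norm (y - z) / r} t"
          unfolding eq using le by (intro mult_left_mono) auto
        also have "\<dots> = \<Phi> t y"
          unfolding \<Phi>_def by (simp only: mult_ac)
        finally show "ennreal (inverse t ^ ?n) * \<Psi> t (T y) \<le> \<Phi> t y" .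
      qed
      finally show ?thesis .
    next
      case False
      have "\<Psi> t x = 0" for x
      proof -
        \<comment> \<open>Nonpositive \<open>t\<close> would correspond to radii s below
          \<open>a\<close>, where the indicator vanishes.\<close>
        have "t * norm (x - z) \<le> 0" using False by (simp add: mult_nonpos_nonneg)
        then show ?thesis using \<open>0 < a\<close> by (simp add: \<Psi>_def)
      qed
      then show ?thesis by simp
    qed
  qed
  also have "\<dots> = (\<integral>\<^sup>+y. (\<integral>\<^sup>+t. \<Phi> t y \<partial>lborel) \<partial>lborel)"
    by (intro lborel_pair.Fubini'[symmetric]) measurable
  also have "\<dots> \<le> (\<integral>\<^sup>+y. ennreal (r * (r / a) ^ (?n - 1) / real ?n) * w y \<partial>lborel)"
  proof (rule nn_integral_mono)
    fix y :: 'a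
    let ?d = "norm (y - z)"
    show "(\<integral>\<^sup>+t. \<Phi> t y \<partial>lborel) \<le> ennreal (r * (r / a) ^ (?n - 1) / real ?n) * w y"
    proof (cases "a \<le> ?d \<and> ?d \<le> r")
      case True
      then have d: "?d > 0" "a \<le> ?d" using \<open>0 < a\<close> by auto
      have "(\<integral>\<^sup>+t. \<Phi> t y \<partial>lborel) = (w y * indicator {a..r} ?d * ennreal ?d) *
          (\<integral>\<^sup>+t. ennreal (inverse t ^ Suc ?n) * indicator {t. t > ?d / r} t \<partial>lborel)"
        unfolding \<Phi>_def by (intro nn_integral_cmult) measurable
      also have "\<dots> \<le> (w y * indicator {a..r} ?d * ennreal ?d) * ennreal ((inverse (?d / r) ^ ?n / real ?n))"
        using d \<open>0 < r\<close> by (intro mult_left_mono nn_integral_inverse_power_le) auto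
      also have "\<dots> = w y * ennreal (?d * (inverse (?d / r) ^ ?n / real ?n))"
        using True d \<open>0 < r\<close> by (simp add: mult.assoc flip: ennreal_mult)
      \<comment> \<open>With d = |y - z|, the left factor is d (r/d)^n / n = r (r/d)^(n-1) / n, and
        d is at least \<open>a\<close>.\<close>
      also have "\<dots> \<le> w y * ennreal (r * (r / a) ^ (?n - 1) / real ?n)"
      proof (intro mult_left_mono ennreal_leI)
        obtain m where m: "?n = Suc m" using DIM_positive[where 'a = 'a] gr0_conv_Suc by blast
        have aux: "x * (r / x * X / N) = r * X / N" if "x > 0" for x X N :: real
          using that by simp
        have "(r / ?d) ^ m \<le> (r / a) ^ m"
          using d \<open>0 < a\<close> \<open>0 < r\<close> by (intro power_mono divide_left_mono) auto
        then have "r * (r / ?d) ^ m / real ?n \<le> r * (r / a) ^ m / real ?n"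
          using \<open>0 < r\<close> by (intro divide_right_mono mult_left_mono) auto
        moreover have "?d * (inverse (?d / r) ^ ?n / real ?n) = r * (r / ?d) ^ m / real ?n"
          by (simp only: m power_Suc inverse_divide aux[OF d(1)])
        ultimately show "?d * (inverse (?d / r) ^ ?n / real ?n) \<le> r * (r / a) ^ (?n - 1) / real ?n"
          unfolding m by simp
      qed simp
      finally show ?thesis by (simp add: mult.commute)
    next
      case False
      then show ?thesis by (auto simp: \<Phi>_def)
    qed
  qed
  also have "\<dots> = ennreal (r * (r / a) ^ (?n - 1) / real ?n) * (\<integral>\<^sup>+y. w y \<partial>lborel)"
    by (intro nn_integral_cmult) measurable
  finally show ?thesis .
qed

text \<open>Jensen's inequality for \<open>t \<mapsto> t\<^sup>p\<close>, by integrating the tangent line at the mean slope.\<close>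

lemma powr_le_integral_deriv_powr:
  fixes v v' k :: "real \<Rightarrow> real"
  assumes "a < r" "1 < p"
    and v: "\<And>s. s \<in> {a..r} \<Longrightarrow> (v has_real_derivative v' s) (at s within {a..r})"
    and "v a = 0" and k: "\<And>s. s \<in> {a..r} \<Longrightarrow> \<bar>v' s\<bar> \<le> k s" and cont: "continuous_on {a..r} k"
  shows "\<bar>v r\<bar> powr p \<le> (r - a) powr (p - 1) * integral {a..r} (\<lambda>s. k s powr p)"
proof -
  define m where "m = \<bar>v r\<bar> / (r - a)"
  have m: "m \<ge> 0" using \<open>a < r\<close> by (simp add: m_def)
  have vr: "\<bar>v r\<bar> = (r - a) * m" using \<open>a < r\<close> by (simp add: m_def)
  \<comment> \<open>Young's inequality for \<open>y\<close> and \<open>m powr (p - 1)\<close> with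
    exponents p and p/(p-1). Allowing any \<open>x\<close> below \<open>y\<close> admits negative
    slopes.\<close>
  have tangent: "m powr p + p * m powr (p - 1) * (x - m) \<le> y powr p" if "x \<le> y" "0 \<le> y" for x y
  proof -
    have "y * m powr (p - 1) \<le> y powr p / p + (m powr (p - 1)) powr (p / (p - 1)) / (p / (p - 1))"
      using \<open>1 < p\<close> that by (intro Youngs_inequality) (auto simp: field_simps)
    also have "(m powr (p - 1)) powr (p / (p - 1)) = m powr p"
      using \<open>1 < p\<close> by (simp add: powr_powr)
    finally have "p * (y * m powr (p - 1)) \<le> y powr p + (p - 1) * m powr p"
      using \<open>1 < p\<close> by (simp add: field_simps)
    moreover have "p * (x * m powr (p - 1)) \<le> p * (y * m powr (p - 1))"
      using \<open>1 < p\<close> that by (intro mult_left_mono mult_right_mono) auto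
    moreover have "m * m powr (p - 1) = m powr p"
      using powr_mult_base[OF m, of "p - 1"] by simp
    ultimately show ?thesis by (simp add: algebra_simps)
  qed
  \<comment> \<open>The sign makes the mean of \<open>\<sigma> * v' s\<close> exactly
    \<open>m\<close>, so the linear term of the tangent integrates to 0.\<close>
  define \<sigma> where "\<sigma> = sgn (v r)"
  have "((\<lambda>s. v' s) has_integral v r - v a) {a..r}"
    using v \<open>a < r\<close> by (intro fundamental_theorem_of_calculus)
      (auto simp flip: has_real_derivative_iff_has_vector_derivative)
  then have "((\<lambda>s. \<sigma> * v' s) has_integral \<sigma> * v r) {a..r}"
    using \<open>v a = 0\<close> by (auto intro: has_integral_mult_right)
  moreover have "\<sigma> * v r = (r - a) * m"
    using vr by (simp add: \<sigma>_def sgn_mult_self_eq abs_sgn mult.commute)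
  ultimately have I: "((\<lambda>s. \<sigma> * v' s) has_integral (r - a) * m) {a..r}" by simp
  have c: "((\<lambda>s. c) has_integral (r - a) * c) {a..r}" for c :: real
    using has_integral_const_real[of c a r] \<open>a < r\<close> by simp
  have "((\<lambda>s. m powr p + p * m powr (p - 1) * (\<sigma> * v' s - m)) has_integral
      ((r - a) * m powr p + p * m powr (p - 1) * ((r - a) * m - (r - a) * m))) {a..r}"
    by (intro has_integral_add has_integral_mult_right has_integral_diff c I)
  moreover have "((\<lambda>s. k s powr p) has_integral integral {a..r} (\<lambda>s. k s powr p)) {a..r}"
  proof -
    have "continuous_on {a..r} (\<lambda>s. k s powr p)"
      using k \<open>1 < p\<close> by (intro continuous_on_powr' cont continuous_intros) force+
    then show ?thesis
      by (intro integrable_integral integrable_continuous_interval)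
  qed
  moreover have "m powr p + p * m powr (p - 1) * (\<sigma> * v' s - m) \<le> k s powr p" if "s \<in> {a..r}" for s
  proof (rule tangent)
    have "\<bar>\<sigma> * v' s\<bar> \<le> \<bar>v' s\<bar>" by (simp add: \<sigma>_def abs_mult abs_sgn_eq)
    then show "\<sigma> * v' s \<le> k s" "0 \<le> k s" using k[OF that] by linarith+
  qed
  ultimately have "(r - a) * m powr p \<le> integral {a..r} (\<lambda>s. k s powr p)"
    by (drule_tac has_integral_le) auto
  then have "(r - a) powr (p - 1) * ((r - a) * m powr p) \<le> (r - a) powr (p - 1) * integral {a..r} (\<lambda>s. k s powr p)"
    by (rule mult_left_mono) simp
  moreover have "\<bar>v r\<bar> powr p = (r - a) powr (p - 1) * ((r - a) * m powr p)"
    using powr_mult_base[of "r - a" "p - 1"] \<open>a < r\<close> m by (simp add: vr powr_mult mult_ac)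
  ultimately show ?thesis by simp
qed

section \<open>Unique continuation\<close>

lemma sphere_integral_le_energy:
  fixes u :: "'a::euclidean_space \<Rightarrow> real"
  assumes C1: "Ck_on 1 G u" and sub: "cball z r \<subseteq> G" and a: "0 < a" "a < r" and "1 < p"
    and zero: "\<And>x. x \<in> ball z a \<Longrightarrow> u x = 0"
  shows "sphere_integral p u z r \<le> (r - a) powr (p - 1) * (r / a) ^ (DIM('a) - 1) *
    (LINT x:ball z r|lebesgue. norm (grad u x) powr p)"
proof -
  let ?O = "ball z r - {z}"
  have r: "0 < r" using a by simp
  note Du = Ck_on_1_GDERIV[OF C1] and cDu = Ck_on_1_continuous_grad[OF C1]
  note cu = continuous_on_subset[OF Ck_on_1_continuous[OF C1] sub]
  have cpow: "continuous_on S (\<lambda>x. norm (grad u x) powr p)" if "S \<subseteq> G" for S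
    using \<open>1 < p\<close> by (intro continuous_on_powr' continuous_intros continuous_on_subset[OF cDu that]) auto
  define W where "W x = indicator (ball z r) x *\<^sub>R (norm (grad u x) powr p)" for x
  define E where "E = integral\<^sup>L lborel W"
  have Wm [measurable]: "W \<in> borel_measurable borel"
    unfolding W_def[abs_def] using sub by (intro borel_measurable_continuous_on_indicator cpow) auto
  have "integrable lborel (\<lambda>x. indicator (ball z r) x *\<^sub>R (indicator (cball z r) x *\<^sub>R (norm (grad u x) powr p)))"
    using sub by (intro integrable_mult_indicator borel_integrable_compact cpow) auto
  moreover have "(\<lambda>x. indicator (ball z r) x *\<^sub>R (indicator (cball z r) x *\<^sub>R (norm (grad u x) powr p))) = W"
    by (auto simp: W_def fun_eq_iff indicator_def)
  ultimately have W_int: "integrable lborel W" by simp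
  have W_nonneg: "W x \<ge> 0" for x by (simp add: W_def)
  have E: "(LINT x:ball z r|lebesgue. norm (grad u x) powr p) = E"
    using set_lebesgue_integral_lborel[OF Wm[unfolded W_def[abs_def]]]
    by (simp add: E_def set_lebesgue_integral_def W_def[abs_def])
  have E_nonneg: "E \<ge> 0" unfolding E_def using W_nonneg by simp
  define c where "c = (r - a) powr (p - 1)"
  have c: "c \<ge> 0" by (simp add: c_def)
  \<comment> \<open>The rays are followed from the sphere of radius \<open>a\<close>, which the open
    zero ball reaches only by continuity.\<close>
  have u_a: "u y = 0" if "y \<in> cball z a" for y
    by (rule continuous_constant_on_closure[of "ball z a"])
      (use that zero a continuous_on_subset[OF cu subset_cball] in auto)

  have radial: "ennreal (\<bar>u (radial_proj z r x)\<bar> powr p) \<le>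
      (\<integral>\<^sup>+s. ennreal (c * W (radial_proj z s x)) * indicator {a..r} s \<partial>lborel)" if x: "x \<in> ?O" for x
  proof -
    define e where "e = (1 / norm (x - z)) *\<^sub>R (x - z)"
    have e: "norm e = 1" using x by (simp add: e_def)
    have P: "radial_proj z s x = z + s *\<^sub>R e" for s by (simp add: e_def)
    have mem: "z + s *\<^sub>R e \<in> cball z r" if "s \<in> {a..r}" for s
      using that a e by (simp add: dist_norm)
    define k where "k s = norm (grad u (z + s *\<^sub>R e))" for s
    have ck: "continuous_on {a..r} k"
      unfolding k_def
      by (intro continuous_on_compose2[OF continuous_on_norm[OF cDu]] continuous_intros) (use mem sub in auto)
    have "\<bar>u (z + r *\<^sub>R e)\<bar> powr p \<le> (r - a) powr (p - 1) * integral {a..r} (\<lambda>s. k s powr p)"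
    proof (rule powr_le_integral_deriv_powr[where v = "\<lambda>s. u (z + s *\<^sub>R e)" and v' = "\<lambda>s. e \<bullet> grad u (z + s *\<^sub>R e)"])
      fix s assume s: "s \<in> {a..r}"
      show "\<bar>e \<bullet> grad u (z + s *\<^sub>R e)\<bar> \<le> k s"
        using Cauchy_Schwarz_ineq2[of e "grad u (z + s *\<^sub>R e)"] e by (simp add: k_def)
      have "((\<lambda>s. z + s *\<^sub>R e) has_derivative (\<lambda>h. h *\<^sub>R e)) (at s within {a..r})"
        by (auto intro!: derivative_eq_intros)
      moreover have "(u has_derivative (\<lambda>h. h \<bullet> grad u (z + s *\<^sub>R e))) (at (z + s *\<^sub>R e))"
        using Du[of "z + s *\<^sub>R e"] mem[OF s] sub by (auto simp: gderiv_def)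
      ultimately have "((\<lambda>s. u (z + s *\<^sub>R e)) has_derivative (\<lambda>h. (h *\<^sub>R e) \<bullet> grad u (z + s *\<^sub>R e))) (at s within {a..r})"
        by (rule has_derivative_compose)
      then show "((\<lambda>s. u (z + s *\<^sub>R e)) has_real_derivative e \<bullet> grad u (z + s *\<^sub>R e)) (at s within {a..r})"
        by (simp add: has_field_derivative_def mult_commute_abs)
    next
      show "u (z + a *\<^sub>R e) = 0" using a e by (intro u_a) (simp add: dist_norm)
    qed (use a \<open>1 < p\<close> ck in auto)
    then have "ennreal (\<bar>u (z + r *\<^sub>R e)\<bar> powr p) \<le> ennreal c * ennreal (integral {a..r} (\<lambda>s. k s powr p))"
      by (simp add: c_def ennreal_leI flip: ennreal_mult')
    also have "ennreal (integral {a..r} (\<lambda>s. k s powr p)) = (\<integral>\<^sup>+s. ennreal (indicator {a..r} s *\<^sub>R (k s powr p)) \<partial>lborel)"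
    proof -
      have "continuous_on {a..r} (\<lambda>s. k s powr p)"
        using \<open>1 < p\<close> by (intro continuous_on_powr' ck continuous_intros) (auto simp: k_def)
      from borel_integrable_atLeastAtMost'[OF this]
      have "set_integrable lborel {a..r} (\<lambda>s. k s powr p)" .
      then show ?thesis
        using nn_integral_eq_integral[of lborel "\<lambda>s. indicator {a..r} s *\<^sub>R (k s powr p)"]
          set_borel_integral_eq_integral(2)[of "{a..r}" "\<lambda>s. k s powr p"]
        unfolding set_integrable_def set_lebesgue_integral_def by simp
    qed
    also have "\<dots> = (\<integral>\<^sup>+s. ennreal (W (radial_proj z s x)) * indicator {a..r} s \<partial>lborel)"
    proof (rule nn_integral_cong_AE)
      \<comment> \<open>\<open>W\<close> is cut off to the open ball, so it can differ from
        \<open>k s powr p\<close> at the endpoint.\<close>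
      have "AE s in lborel. s \<noteq> r" by (rule AE_lborel_singleton)
      then show "AE s in lborel. ennreal (indicator {a..r} s *\<^sub>R (k s powr p)) =
          ennreal (W (radial_proj z s x)) * indicator {a..r} s"
      proof eventually_elim
        case (elim s)
        have "z + s *\<^sub>R e \<in> ball z r" if "s \<in> {a..r}"
          using that elim a e by (simp add: dist_norm)
        then show ?case
          unfolding P by (auto simp: W_def k_def split: split_indicator)
      qed
    qed
    also have "ennreal c * \<dots> = (\<integral>\<^sup>+s. ennreal c * (ennreal (W (radial_proj z s x)) * indicator {a..r} s) \<partial>lborel)"
      by (intro nn_integral_cmult[symmetric]) measurable
    also have "\<dots> = (\<integral>\<^sup>+s. ennreal (c * W (radial_proj z s x)) * indicator {a..r} s \<partial>lborel)"
      using c W_nonneg by (simp add: ennreal_mult mult.assoc)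
    finally show ?thesis unfolding P .
  qed

  have nn: "0 \<le> r * (r / a) ^ (DIM('a) - 1) / real DIM('a)" "0 \<le> c * E" "0 \<le> real DIM('a) / r"
    using a r c E_nonneg by auto
  have "ennreal (sphere_integral p u z r) = ennreal (real DIM('a) / r) *
      (\<integral>\<^sup>+x. ennreal (\<bar>u (radial_proj z r x)\<bar> powr p) * indicator ?O x \<partial>lborel)"
    using continuous_on_subset[OF cu sphere_cball] r \<open>1 < p\<close> by (intro ennreal_sphere_integral) auto
  also have "\<dots> \<le> ennreal (real DIM('a) / r) * (\<integral>\<^sup>+x. (\<integral>\<^sup>+s. ennreal (c * W (radial_proj z s x)) *
      indicator {a..r} s \<partial>lborel) * indicator ?O x \<partial>lborel)"
    using radial by (intro mult_left_mono nn_integral_mono) (auto split: split_indicator)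
  also have "\<dots> \<le> ennreal (real DIM('a) / r) * (ennreal (r * (r / a) ^ (DIM('a) - 1) / real DIM('a)) *
      (\<integral>\<^sup>+y. ennreal (c * W y) \<partial>lborel))"
    using a r by (intro mult_left_mono nn_integral_radial_le) auto
  also have "(\<integral>\<^sup>+y. ennreal (c * W y) \<partial>lborel) = ennreal (c * E)"
    using c W_nonneg W_int by (subst nn_integral_eq_integral) (auto simp: E_def)
  also have "ennreal (real DIM('a) / r) * (ennreal (r * (r / a) ^ (DIM('a) - 1) / real DIM('a)) * ennreal (c * E)) =
      ennreal (real DIM('a) / r * (r * (r / a) ^ (DIM('a) - 1) / real DIM('a) * (c * E)))"
    by (simp only: ennreal_mult[OF nn(1,2), symmetric] ennreal_mult'[OF nn(3), symmetric])
  \<comment> \<open>The factor n/r of the surface measure cancels r/n from the radial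
    estimate.\<close>
  also have "real DIM('a) / r * (r * (r / a) ^ (DIM('a) - 1) / real DIM('a) * (c * E)) =
      c * (r / a) ^ (DIM('a) - 1) * E"
    using r by simp
  finally show ?thesis
    using a r c E_nonneg unfolding E c_def by (subst (asm) ennreal_le_iff) auto
qed

section \<open>Propagation of zero balls\<close>

lemma p_laplace_zero_ball_expands:
  fixes u :: "'a::euclidean_space \<Rightarrow> real"
  assumes sol: "p_laplace_solution p G u" and "open G" and "1 < p"
    and a: "0 < a" "a < R" and sub: "cball z R \<subseteq> G"
    and freq: "(\<forall>r\<in>{a<..R}. sphere_integral p u z r > 0) \<Longrightarrow>
      esssup (lebesgue_on {a<..R}) (\<lambda>r. ereal \<bar>frequency p u z r\<bar>) < \<infinity>"
    and zero: "\<And>x. x \<in> ball z a \<Longrightarrow> u x = 0"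
  shows "\<exists>r. a < r \<and> r \<le> R \<and> (\<forall>x\<in>ball z r. u x = 0)"
proof (rule ccontr)
  assume not: "\<not> ?thesis"
  have C1: "Ck_on 1 G u" using sol by (simp add: p_laplace_solution_def)
  \<comment> \<open>If the ball cannot grow, \<open>I\<close> is positive on the whole interval,
    which is what the frequency hypothesis asks for: a zero of \<open>I\<close> would already give a
    larger zero ball.\<close>
  have pos: "sphere_integral p u z r > 0" if r: "r \<in> {a<..R}" for r
  proof (rule ccontr)
    assume *: "\<not> sphere_integral p u z r > 0"
    have subr: "cball z r \<subseteq> G" using r sub by (meson greaterThanAtMost_iff subset_cball subset_trans)
    have "continuous_on (sphere z r) u"
      using continuous_on_subset[OF Ck_on_1_continuous[OF C1]] subr sphere_cball by (metis subset_trans)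
    then have "u x = 0" if "x \<in> sphere z r" for x
      using sphere_integral_0_imp_0[of z r u p x] * that r a \<open>1 < p\<close> by auto
    then have "\<forall>x\<in>ball z r. u x = 0"
      using p_laplace_zero_boundary[OF sol \<open>open G\<close> \<open>1 < p\<close> _ subr] r a by auto
    then show False using not r by auto
  qed
  define f where "f r = ereal \<bar>frequency p u z r\<bar>" for r
  have "esssup (lebesgue_on {a<..R}) f < \<infinity>"
    unfolding f_def[abs_def] using freq pos by blast
  then obtain M where M: "esssup (lebesgue_on {a<..R}) f \<le> ereal M"
    by (cases "esssup (lebesgue_on {a<..R}) f") auto
  have "AE r in lebesgue_on {a<..R}. f r \<le> ereal M"
    using esssup_AE[of f "lebesgue_on {a<..R}"] by eventually_elim (use M in auto)
  then have AE: "AE r in lebesgue. r \<in> {a<..R} \<longrightarrow> f r \<le> ereal M"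
    by (subst (asm) AE_restrict_space_iff) auto
  \<comment> \<open>The energy estimate together with r D(r) <= M I(r) gives r I(r) <=
    \<open>K r\<close> I(r). As \<open>K r\<close> tends to 0 at \<open>a\<close>, it falls below
    \<open>a\<close>, hence below \<open>r\<close>.\<close>
  define K where "K r = (r - a) powr (p - 1) * (r / a) ^ (DIM('a) - 1) * M" for r
  have "(K \<longlongrightarrow> (a - a) powr (p - 1) * (a / a) ^ (DIM('a) - 1) * M) (at_right a)"
    unfolding K_def
    using \<open>1 < p\<close> a by (intro tendsto_intros tendsto_powr2) (auto simp: eventually_at_filter)
  then have "eventually (\<lambda>r. K r < a) (at_right a)"
    using a \<open>1 < p\<close> by (auto dest: order_tendstoD(2))
  then obtain b where b: "b > a" "\<And>r. a < r \<Longrightarrow> r < b \<Longrightarrow> K r < a"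
    unfolding eventually_at_right_field by auto
  \<comment> \<open>The bound holds only almost everywhere, but a nonempty open interval is not
    null.\<close>
  have "\<exists>r. r \<in> {a<..<min b R} \<and> f r \<le> ereal M"
  proof (rule ccontr)
    assume none: "\<not> ?thesis"
    have "AE r in lebesgue. r \<notin> {a<..<min b R}"
      using AE by eventually_elim (use none in auto)
    then have "{a<..<min b R} \<in> null_sets lebesgue"
      by (subst AE_iff_null_sets) auto
    then show False
      using open_not_negligible[of "{a<..<min b R}"] a b(1) by (auto simp: negligible_iff_null_sets)
  qed
  then obtain r where r: "a < r" "r < b" "r < R" and Fr: "\<bar>frequency p u z r\<bar> \<le> M"
    by (auto simp: f_def)
  define I where "I = sphere_integral p u z r"
  define E where "E = (LINT x:ball z r|lebesgue. norm (grad u x) powr p)"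
  define c where "c = (r - a) powr (p - 1) * (r / a) ^ (DIM('a) - 1)"
  have I: "I > 0" using pos r by (simp add: I_def)
  have "r * E / I \<le> M"
    using abs_ge_self[of "frequency p u z r"] Fr unfolding frequency_def I_def E_def by linarith
  then have "r * E \<le> M * I" using I by (simp add: field_simps)
  have c: "c \<ge> 0" using a r by (simp add: c_def)
  have subr: "cball z r \<subseteq> G" using r sub by (meson less_imp_le subset_cball subset_trans)
  have "I \<le> c * E"
    unfolding I_def c_def E_def
    using sphere_integral_le_energy[OF C1 subr a(1) r(1) \<open>1 < p\<close> zero] .
  then have "r * I \<le> c * (r * E)"
    using a r(1) by (simp add: mult.left_commute)
  also have "\<dots> \<le> c * (M * I)"
    using \<open>r * E \<le> M * I\<close> c by (rule mult_left_mono)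
  also have "\<dots> = K r * I" by (simp add: K_def c_def)
  finally have "r \<le> K r" using I by simp
  then show False using b(2)[OF r(1,2)] r(1) by simp
qed

text \<open>An open ball is the union of the smaller concentric ones, so the supremum of the radii
  of zero balls is again such a radius. Below \<open>R\<close> it could still be enlarged.\<close>

lemma p_laplace_zero_ball_maximal:
  fixes u :: "'a::euclidean_space \<Rightarrow> real"
  assumes sol: "p_laplace_solution p G u" and "open G" and "1 < p"
    and freq: "\<And>a R. 0 < a \<Longrightarrow> a < R \<Longrightarrow> cball z R \<subseteq> G \<Longrightarrow>
      (\<forall>r\<in>{a<..R}. sphere_integral p u z r > 0) \<Longrightarrow>
      esssup (lebesgue_on {a<..R}) (\<lambda>r. ereal \<bar>frequency p u z r\<bar>) < \<infinity>"
    and a: "0 < a" and zero: "\<And>x. x \<in> ball z a \<Longrightarrow> u x = 0"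
    and R: "cball z R \<subseteq> G" and y: "y \<in> ball z R"
  shows "u y = 0"
proof (cases "a < R")
  case False
  then show ?thesis using zero y by auto
next
  case True
  define S where "S = {r. a \<le> r \<and> r \<le> R \<and> (\<forall>x\<in>ball z r. u x = 0)}"
  have aS: "a \<in> S" using True zero by (simp add: S_def)
  have bdd: "bdd_above S" by (auto simp: S_def bdd_above_def)
  define s where "s = Sup S"
  have s: "a \<le> s" "s \<le> R"
    using aS bdd unfolding s_def by (auto intro: cSup_upper cSup_least simp: S_def)
  have zs: "u x = 0" if "x \<in> ball z s" for x
  proof -
    have "dist z x < Sup S" using that by (simp add: s_def)
    then obtain r where "r \<in> S" "dist z x < r" using less_cSup_iff[of S] aS bdd by auto
    then show ?thesis by (simp add: S_def)
  qed
  have "s = R"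
  proof (rule ccontr)
    assume "s \<noteq> R"
    then obtain r where "s < r" "r \<le> R" "\<forall>x\<in>ball z r. u x = 0"
      using p_laplace_zero_ball_expands[OF sol \<open>open G\<close> \<open>1 < p\<close> _ _ R freq zs, of s] s a R by auto
    then have "r \<in> S" using s by (simp add: S_def)
    then show False using cSup_upper[OF _ bdd] \<open>s < r\<close> unfolding s_def by force
  qed
  then show ?thesis using zs y by simp
qed

lemma p_laplace_unique_continuation:
  fixes u :: "'a::euclidean_space \<Rightarrow> real"
  assumes "1 < p" "open G" "connected G" and sol: "p_laplace_solution p G u"
    and freq: "\<And>z a R. 0 < a \<Longrightarrow> a < R \<Longrightarrow> cball z R \<subseteq> G \<Longrightarrow>
      (\<forall>r\<in>{a<..R}. sphere_integral p u z r > 0) \<Longrightarrow>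
      esssup (lebesgue_on {a<..R}) (\<lambda>r. ereal \<bar>frequency p u z r\<bar>) < \<infinity>"
    and c: "0 < \<rho>" "ball c \<rho> \<subseteq> G" "\<And>x. x \<in> ball c \<rho> \<Longrightarrow> u x = 0"
    and "x \<in> G"
  shows "u x = 0"
proof -
  define T where "T = {z \<in> G. \<exists>e>0. \<forall>y\<in>ball z e. u y = 0}"
  have opT: "open T"
    unfolding open_contains_ball
  proof
    fix z assume "z \<in> T"
    then obtain e d where e: "z \<in> G" "e > 0" "\<forall>y\<in>ball z e. u y = 0" and d: "d > 0" "ball z d \<subseteq> G"
      using \<open>open G\<close> by (auto simp: T_def open_contains_ball)
    have "y \<in> T" if y: "y \<in> ball z (min d e)" for y
    proof -
      have "ball y (e - dist z y) \<subseteq> ball z e"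
      proof
        fix x assume "x \<in> ball y (e - dist z y)"
        then show "x \<in> ball z e" using dist_triangle[of z x y] by simp
      qed
      then show ?thesis
        using e d y by (auto simp: T_def intro!: exI[of _ "e - dist z y"])
    qed
    then show "\<exists>e>0. ball z e \<subseteq> T" using e d by (intro exI[of _ "min d e"]) auto
  qed
  have "z \<in> T" if z: "z \<in> G" "z \<in> closure T" for z
  proof -
    obtain d where d: "d > 0" "ball z d \<subseteq> G"
      using \<open>open G\<close> z(1) by (auto simp: open_contains_ball)
    \<comment> \<open>With \<open>w\<close> closer than d/4 to \<open>z\<close>, the closed ball of
      radius d/2 about \<open>w\<close> stays inside the d-ball about \<open>z\<close> and contains
      the d/4-ball about \<open>z\<close>. The zero ball is grown about \<open>w\<close>, so the
      frequency bound is applied at the moving centre \<open>w\<close>.\<close>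
    obtain w where w: "w \<in> T" "dist w z < d / 4"
      using z(2) d(1) unfolding closure_approachable by (meson divide_pos_pos zero_less_numeral)
    then obtain e where e: "e > 0" "\<And>y. y \<in> ball w e \<Longrightarrow> u y = 0" by (auto simp: T_def)
    have "cball w (d / 2) \<subseteq> ball z d"
    proof
      fix y assume "y \<in> cball w (d / 2)"
      then show "y \<in> ball z d"
        using dist_triangle[of z y w] w(2) d(1) by (simp add: dist_commute)
    qed
    then have sub: "cball w (d / 2) \<subseteq> G" using d(2) by blast
    have "u y = 0" if "y \<in> ball z (d / 4)" for y
    proof -
      have "y \<in> ball w (d / 2)"
        using that dist_triangle[of w y z] w(2) by (simp add: dist_commute)
      then show ?thesis
        using p_laplace_zero_ball_maximal[OF sol \<open>open G\<close> \<open>1 < p\<close> freq e sub] by blast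
    qed
    then show ?thesis using d(1) z(1) by (auto simp: T_def intro!: exI[of _ "d / 4"])
  qed
  then have "G \<inter> closure T \<subseteq> T" by blast
  moreover have "c \<in> T" using c by (auto simp: T_def)
  moreover have "T \<subseteq> G" by (auto simp: T_def)
  \<comment> \<open>\<open>T\<close> and the complement of its closure are disjoint open sets
    covering \<open>G\<close>, and \<open>c\<close> lies in \<open>T\<close>.\<close>
  ultimately have "G \<subseteq> T"
    using connectedD[OF \<open>connected G\<close> opT, of "- closure T"] closure_subset[of T] by blast
  then show ?thesis using \<open>x \<in> G\<close> by (force simp: T_def)
qed

theorem theorem2p7:
  fixes G :: "(real ^ 'n) set" and u :: "real ^ 'n \<Rightarrow> real" and p :: real
  assumes "CARD('n) \<ge> 2"
    and "1 < p"
    and "open G" and "connected G"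
    and "p_laplace_solution p G u"
    and "\<And>z rb Rb. 0 < rb \<Longrightarrow> rb < Rb \<Longrightarrow> cball z Rb \<subseteq> G \<Longrightarrow>
          (\<forall>r\<in>{rb<..Rb}. sphere_integral p u z r > 0) \<Longrightarrow>
          esssup (lebesgue_on {rb<..Rb}) (\<lambda>r. ereal \<bar>frequency p u z r\<bar>) < \<infinity>"
    and "\<exists>c \<rho>. 0 < \<rho> \<and> ball c \<rho> \<subseteq> G \<and> (\<forall>x\<in>ball c \<rho>. u x = 0)"
  shows "\<forall>x\<in>G. u x = 0"
proof
  fix x assume "x \<in> G"
  obtain c \<rho> where "0 < \<rho>" "ball c \<rho> \<subseteq> G" "\<And>x. x \<in> ball c \<rho> \<Longrightarrow> u x = 0"
    using assms(7) by blast
  from p_laplace_unique_continuation[OF assms(2-6) this \<open>x \<in> G\<close>] show "u x = 0" .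
qed

end
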